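(* Let $\pi$ be a positive continuous probability density on $\mathbb{R}$, and let $q:\mathbb{R}^2\to[0,\infty)$ be a bounded continuous function such that $q(x,\cdot)$ is a probability density for every $x\in\mathbb{R}$ and such that, for some $s>0$, $q(x,x+u)=0$ whenever $|u|>s$ (for all $x$). Let $P$ be the associated Metropolis–Hastings operator on $L^2(\pi)$ and $r(\cdot)$, $t(\cdot,\cdot)$ as in the context. For $a>0$ set $$r_a:=\sup_{|x|\le a} r(x),\quad r_a':=\sup_{|x|>a} r(x),\quad \beta_a:=\int_{-s}^{s}\sup_{|x|>a}\sqrt{t(x,x+u)\,t(x+u,x)}\,du,$$ and $\alpha_a:=\max(r_a,\ r_a'+\beta_a)$. Then for every $a>0$, the essential spectral radius of $P$ on $L^2(\pi)$ satisfies $r_{ess}(P)\le \alpha_a$.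
   Context: Define $t(x,y):=\min\big(q(x,y),\ \pi(y)q(y,x)/\pi(x)\big)$ and $r(x):=1-\int_{\mathbb{R}} t(x,y)\,dy$. The Metropolis–Hastings operator is $(Pf)(x)=r(x)f(x)+\int_{\mathbb{R}} f(y)\,t(x,y)\,dy$, acting on $L^2(\pi)$, the $L^2$ space of the probability measure $\pi(y)\,dy$ (complex-valued functions), with operator norm $\|\cdot\|_2$. The essential spectral radius is $r_{ess}(P):=\lim_{n}\big(\inf_K\|P^n-K\|_2\big)^{1/n}$, the infimum being over compact operators $K$ on $L^2(\pi)$. *)

theory Defs
  imports "HOL-Analysis.Analysis"
begin

definition mh_t :: "(real \<Rightarrow> real) \<Rightarrow> (real \<Rightarrow> real \<Rightarrow> real) \<Rightarrow> real \<Rightarrow> real \<Rightarrow> real" where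
  "mh_t \<pi> q x y = min (q x y) (\<pi> y * q y x / \<pi> x)"

definition mh_r :: "(real \<Rightarrow> real) \<Rightarrow> (real \<Rightarrow> real \<Rightarrow> real) \<Rightarrow> real \<Rightarrow> real" where
  "mh_r \<pi> q x = 1 - (\<integral>y. mh_t \<pi> q x y \<partial>lborel)"

definition mh_op :: "(real \<Rightarrow> real) \<Rightarrow> (real \<Rightarrow> real \<Rightarrow> real) \<Rightarrow> (real \<Rightarrow> complex) \<Rightarrow> (real \<Rightarrow> complex)" where
  "mh_op \<pi> q f = (\<lambda>x. complex_of_real (mh_r \<pi> q x) * f x
                      + (\<integral>y. f y * complex_of_real (mh_t \<pi> q x y) \<partial>lborel))"

text \<open>The probability measure pi(y) dy and the space L^2(pi) (as a space of representatives,
  with the L^2 seminorm).\<close>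

definition pi_measure :: "(real \<Rightarrow> real) \<Rightarrow> real measure" where
  "pi_measure \<pi> = density lborel (\<lambda>x. ennreal (\<pi> x))"

definition L2 :: "(real \<Rightarrow> real) \<Rightarrow> (real \<Rightarrow> complex) set" where
  "L2 \<pi> = {f. f \<in> borel_measurable (pi_measure \<pi>)
              \<and> integrable (pi_measure \<pi>) (\<lambda>x. (cmod (f x))\<^sup>2)}"

definition L2norm :: "(real \<Rightarrow> real) \<Rightarrow> (real \<Rightarrow> complex) \<Rightarrow> real" where
  "L2norm \<pi> f = sqrt (\<integral>x. (cmod (f x))\<^sup>2 \<partial>pi_measure \<pi>)"

text \<open>Compact operators on L^2(pi): linear (up to a.e. equality), mapping L^2 to L^2,
  and mapping the closed unit ball to a relatively compact set (every sequence in the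
  unit ball has a subsequence whose image is Cauchy; L^2 is complete).\<close>

definition L2_compact_op :: "(real \<Rightarrow> real) \<Rightarrow> ((real \<Rightarrow> complex) \<Rightarrow> (real \<Rightarrow> complex)) \<Rightarrow> bool" where
  "L2_compact_op \<pi> K \<longleftrightarrow>
     (\<forall>f\<in>L2 \<pi>. K f \<in> L2 \<pi>) \<and>
     (\<forall>f\<in>L2 \<pi>. \<forall>g\<in>L2 \<pi>. \<forall>c::complex.
        AE x in pi_measure \<pi>. K (\<lambda>y. c * f y + g y) x = c * K f x + K g x) \<and>
     (\<forall>fs::nat \<Rightarrow> real \<Rightarrow> complex. (\<forall>n. fs n \<in> L2 \<pi> \<and> L2norm \<pi> (fs n) \<le> 1) \<longrightarrow>
        (\<exists>\<phi>::nat \<Rightarrow> nat. strict_mono \<phi> \<and>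
           (\<forall>e::real>0. \<exists>N::nat. \<forall>m\<ge>N. \<forall>n\<ge>N.
              L2norm \<pi> (\<lambda>x. K (fs (\<phi> m)) x - K (fs (\<phi> n)) x) < e)))"

definition L2_opnorm :: "(real \<Rightarrow> real) \<Rightarrow> ((real \<Rightarrow> complex) \<Rightarrow> (real \<Rightarrow> complex)) \<Rightarrow> real" where
  "L2_opnorm \<pi> T = (SUP f\<in>{f\<in>L2 \<pi>. L2norm \<pi> f \<le> 1}. L2norm \<pi> (T f))"

definition ess_spec_radius :: "(real \<Rightarrow> real) \<Rightarrow> ((real \<Rightarrow> complex) \<Rightarrow> (real \<Rightarrow> complex)) \<Rightarrow> real" where
  "ess_spec_radius \<pi> T =
     lim (\<lambda>n. (INF K\<in>{K. L2_compact_op \<pi> K}.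
                 L2_opnorm \<pi> (\<lambda>f x. (T ^^ n) f x - K f x)) powr (1 / real n))"

end

theory Submission
  imports Defs "HOL-Complex_Analysis.Great_Picard"
begin

text \<open>
  Let \<open>A = [-a, a]\<close> and split \<open>P = D + K\<close>, where \<open>K\<close> is the integral operator with kernel \<open>t(x,y)\<close>
  restricted to \<open>x \<in> A\<close> or \<open>y \<in> A\<close>. Since \<open>t\<close> is continuous and vanishes for \<open>\<bar>x - y\<bar> > s\<close>, the
  Arzela--Ascoli theorem shows that \<open>K\<close> is compact. The operator \<open>D\<close> is block diagonal: on \<open>A\<close> it is
  the multiplication by \<open>r\<close>, and on the complement it is \<open>r\<close> plus an integral operator which, by
  detailed balance, is conjugate to one on \<open>L\<^sup>2(dx)\<close> with kernel \<open>sqrt (t(x,y) t(y,x))\<close>; a convolution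
  estimate bounds the latter by \<open>\<beta>\<^sub>a\<close>. Hence the norm of \<open>P\<close> modulo compact operators is at most
  \<open>\<alpha>\<^sub>a\<close>. These essential norms are submultiplicative on the powers of \<open>P\<close>, so by Fekete's lemma the
  limit defining the essential spectral radius exists and is the infimum of their \<open>n\<close>-th roots, which
  for \<open>n = 1\<close> is the essential norm of \<open>P\<close>. Only the compactness of \<open>A\<close> matters.
\<close>

section \<open>The seminorm of \<open>L\<^sup>2(\<pi>)\<close>\<close>

lemma sets_pi_measure [simp, measurable_cong]: "sets (pi_measure \<pi>) = sets borel"
  by (simp add: pi_measure_def)

lemma space_pi_measure [simp]: "space (pi_measure \<pi>) = UNIV"
  by (simp add: pi_measure_def)

lemma L2_measurable: "f \<in> L2 \<pi> \<Longrightarrow> f \<in> borel_measurable borel"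
  by (auto simp: L2_def pi_measure_def)

lemma L2_integrable: "f \<in> L2 \<pi> \<Longrightarrow> integrable (pi_measure \<pi>) (\<lambda>x. (cmod (f x))\<^sup>2)"
  by (auto simp: L2_def)

lemma L2_dominated:
  assumes [measurable]: "f \<in> borel_measurable borel" and "integrable (pi_measure \<pi>) g"
    and "\<And>x. (cmod (f x))\<^sup>2 \<le> g x"
  shows "f \<in> L2 \<pi>"
proof -
  have "integrable (pi_measure \<pi>) (\<lambda>x. (cmod (f x))\<^sup>2)"
    by (rule Bochner_Integration.integrable_bound[OF assms(2)])
      (use assms(3) in \<open>auto intro!: AE_I2 order_trans[OF _ abs_ge_self]\<close>)
  then show ?thesis by (simp add: L2_def)
qed

lemma L2_zero: "(\<lambda>x. 0) \<in> L2 \<pi>"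
  by (rule L2_dominated[where g = "\<lambda>_. 0"]) auto

lemma L2_lincomb:
  assumes "f \<in> L2 \<pi>" "g \<in> L2 \<pi>"
  shows "(\<lambda>x. c * f x + g x) \<in> L2 \<pi>"
proof (rule L2_dominated)
  show "(\<lambda>x. c * f x + g x) \<in> borel_measurable borel"
    using assms[THEN L2_measurable] by measurable
  show "integrable (pi_measure \<pi>) (\<lambda>x. 2 * (cmod c)\<^sup>2 * (cmod (f x))\<^sup>2 + 2 * (cmod (g x))\<^sup>2)"
    using assms[THEN L2_integrable] by auto
  fix x
  have "(cmod (c * f x + g x))\<^sup>2 \<le> (cmod c * cmod (f x) + cmod (g x))\<^sup>2"
    by (intro power_mono) (auto simp: norm_mult[symmetric] norm_triangle_ineq)
  also have "\<dots> \<le> 2 * (cmod c)\<^sup>2 * (cmod (f x))\<^sup>2 + 2 * (cmod (g x))\<^sup>2"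
    using sum_squares_bound[of "cmod c * cmod (f x)" "cmod (g x)"]
    by (simp add: power2_sum power_mult_distrib)
  finally show "(cmod (c * f x + g x))\<^sup>2 \<le> 2 * (cmod c)\<^sup>2 * (cmod (f x))\<^sup>2 + 2 * (cmod (g x))\<^sup>2" .
qed

lemma L2_add: "f \<in> L2 \<pi> \<Longrightarrow> g \<in> L2 \<pi> \<Longrightarrow> (\<lambda>x. f x + g x) \<in> L2 \<pi>"
  using L2_lincomb[of f \<pi> g 1] by simp

lemma L2_diff: "f \<in> L2 \<pi> \<Longrightarrow> g \<in> L2 \<pi> \<Longrightarrow> (\<lambda>x. f x - g x) \<in> L2 \<pi>"
  using L2_lincomb[of g \<pi> f "-1"] by simp

lemma L2_cmult: "f \<in> L2 \<pi> \<Longrightarrow> (\<lambda>x. c * f x) \<in> L2 \<pi>"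
  using L2_lincomb[OF _ L2_zero, of f \<pi> c] by simp

lemma L2_mult_bounded:
  assumes "f \<in> L2 \<pi>" "h \<in> borel_measurable borel" "\<And>x. cmod (h x) \<le> C"
  shows "(\<lambda>x. h x * f x) \<in> L2 \<pi>"
proof (rule L2_dominated)
  show "(\<lambda>x. h x * f x) \<in> borel_measurable borel"
    using assms(2) L2_measurable[OF assms(1)] by measurable
  show "integrable (pi_measure \<pi>) (\<lambda>x. C\<^sup>2 * (cmod (f x))\<^sup>2)"
    using L2_integrable[OF assms(1)] by auto
  show "(cmod (h x * f x))\<^sup>2 \<le> C\<^sup>2 * (cmod (f x))\<^sup>2" for x
    using assms(3)[of x] by (auto simp: norm_mult power_mult_distrib intro!: mult_right_mono power_mono)
qed

lemma L2_indicator_mult: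
  "f \<in> L2 \<pi> \<Longrightarrow> A \<in> sets borel \<Longrightarrow> (\<lambda>x. indicator A x * f x) \<in> L2 \<pi>"
  by (rule L2_mult_bounded[where C = 1]) (auto simp: indicator_def)

lemma L2norm_nonneg [simp]: "L2norm \<pi> f \<ge> 0"
  by (simp add: L2norm_def)

lemma L2norm_power2: "(L2norm \<pi> f)\<^sup>2 = (\<integral>x. (cmod (f x))\<^sup>2 \<partial>pi_measure \<pi>)"
  by (simp add: L2norm_def)

lemma L2norm_zero [simp]: "L2norm \<pi> (\<lambda>x. 0) = 0"
  by (simp add: L2norm_def)

lemma L2norm_cmult: "L2norm \<pi> (\<lambda>x. c * f x) = cmod c * L2norm \<pi> f"
  by (simp add: L2norm_def norm_mult power_mult_distrib real_sqrt_mult)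

lemma L2norm_scale_nonneg:
  "c \<ge> 0 \<Longrightarrow> L2norm \<pi> (\<lambda>x. complex_of_real c * f x) = c * L2norm \<pi> f"
  by (simp add: L2norm_cmult)

lemma L2norm_mono_AE:
  assumes "f \<in> L2 \<pi>" "g \<in> L2 \<pi>" "AE x in pi_measure \<pi>. cmod (f x) \<le> cmod (g x)"
  shows "L2norm \<pi> f \<le> L2norm \<pi> g"
  unfolding L2norm_def using assms(3)
  by (intro real_sqrt_le_mono integral_mono_AE L2_integrable assms) (auto intro: power_mono)

lemma L2norm_le_cmult:
  assumes "f \<in> L2 \<pi>" "g \<in> L2 \<pi>" "C \<ge> 0" "\<And>x. cmod (g x) \<le> C * cmod (f x)"
  shows "L2norm \<pi> g \<le> C * L2norm \<pi> f"
proof -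
  have "L2norm \<pi> g \<le> L2norm \<pi> (\<lambda>x. complex_of_real C * f x)"
    by (intro L2norm_mono_AE L2_cmult AE_I2 assms(1,2)) (simp add: norm_mult assms(3,4))
  then show ?thesis by (simp add: L2norm_scale_nonneg assms(3))
qed

lemma L2norm_cong_AE:
  assumes "f \<in> L2 \<pi>" "g \<in> L2 \<pi>" "AE x in pi_measure \<pi>. f x = g x"
  shows "L2norm \<pi> f = L2norm \<pi> g"
  by (intro antisym L2norm_mono_AE assms; use assms(3) in auto)

lemma L2norm_eq_0_imp_AE:
  assumes "f \<in> L2 \<pi>" "L2norm \<pi> f = 0"
  shows "AE x in pi_measure \<pi>. f x = 0"
proof -
  have "(\<integral>x. (cmod (f x))\<^sup>2 \<partial>pi_measure \<pi>) = 0"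
    using assms(2) L2norm_power2[of \<pi> f] by simp
  then have "AE x in pi_measure \<pi>. (cmod (f x))\<^sup>2 = 0"
    using integral_nonneg_eq_0_iff_AE[OF L2_integrable[OF assms(1)]] by simp
  then show ?thesis by simp
qed

lemma nn_integral_cmod_power2:
  assumes "f \<in> L2 \<pi>"
  shows "(\<integral>\<^sup>+x. (ennreal (cmod (f x)))\<^sup>2 \<partial>pi_measure \<pi>) = ennreal ((L2norm \<pi> f)\<^sup>2)"
  unfolding L2norm_power2
  by (simp add: ennreal_power nn_integral_eq_integral[OF L2_integrable[OF assms]])

lemma L2_nn_integralI:
  assumes [measurable]: "f \<in> borel_measurable borel" and "C \<ge> 0"
    and bound: "(\<integral>\<^sup>+x. (ennreal (cmod (f x)))\<^sup>2 \<partial>pi_measure \<pi>) \<le> ennreal (C\<^sup>2)"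
  shows "f \<in> L2 \<pi>" and "L2norm \<pi> f \<le> C"
proof -
  have "integrable (pi_measure \<pi>) (\<lambda>x. (cmod (f x))\<^sup>2)"
    using le_less_trans[OF bound ennreal_less_top]
    by (intro integrableI_bounded) (auto simp: ennreal_power)
  then show f: "f \<in> L2 \<pi>" by (simp add: L2_def)
  have "(L2norm \<pi> f)\<^sup>2 \<le> C\<^sup>2"
    using bound by (simp add: nn_integral_cmod_power2[OF f])
  then show "L2norm \<pi> f \<le> C" by (rule power2_le_imp_le) fact
qed

lemma ennreal_power2_le_imp_le:
  assumes "x\<^sup>2 \<le> ennreal (c\<^sup>2)" "c \<ge> 0"
  shows "x \<le> ennreal c"
proof (cases x)
  case (real r)
  then have "r\<^sup>2 \<le> c\<^sup>2" using assms(1) by (simp add: ennreal_power)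
  then show ?thesis using real assms(2) power2_le_imp_le by simp
next
  case top
  then show ?thesis using assms(1) by (simp add: top_unique)
qed

lemma L2_Cauchy_Schwarz:
  assumes f: "f \<in> L2 \<pi>" and g: "g \<in> L2 \<pi>"
  shows "integrable (pi_measure \<pi>) (\<lambda>x. cmod (f x) * cmod (g x))"
    and "(\<integral>x. cmod (f x) * cmod (g x) \<partial>pi_measure \<pi>) \<le> L2norm \<pi> f * L2norm \<pi> g"
proof -
  note [measurable] = f[THEN L2_measurable] g[THEN L2_measurable]
  have "(\<integral>\<^sup>+x. ennreal (cmod (f x)) * ennreal (cmod (g x)) \<partial>pi_measure \<pi>)\<^sup>2
      \<le> ennreal ((L2norm \<pi> f)\<^sup>2) * ennreal ((L2norm \<pi> g)\<^sup>2)"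
    unfolding nn_integral_cmod_power2[OF f, symmetric] nn_integral_cmod_power2[OF g, symmetric]
    by (rule Cauchy_Schwarz_nn_integral) measurable
  then have bound: "(\<integral>\<^sup>+x. ennreal (cmod (f x) * cmod (g x)) \<partial>pi_measure \<pi>)
      \<le> ennreal (L2norm \<pi> f * L2norm \<pi> g)"
    by - (rule ennreal_power2_le_imp_le, simp_all add: ennreal_mult power_mult_distrib)
  show int: "integrable (pi_measure \<pi>) (\<lambda>x. cmod (f x) * cmod (g x))"
    using le_less_trans[OF bound ennreal_less_top] by (intro integrableI_bounded) simp_all
  show "(\<integral>x. cmod (f x) * cmod (g x) \<partial>pi_measure \<pi>) \<le> L2norm \<pi> f * L2norm \<pi> g"
    using bound by (simp add: nn_integral_eq_integral[OF int])
qed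

lemma L2norm_triangle:
  assumes f: "f \<in> L2 \<pi>" and g: "g \<in> L2 \<pi>"
  shows "L2norm \<pi> (\<lambda>x. f x + g x) \<le> L2norm \<pi> f + L2norm \<pi> g"
proof -
  note int = L2_integrable[OF f] L2_integrable[OF g] L2_Cauchy_Schwarz(1)[OF f g]
  have "(L2norm \<pi> (\<lambda>x. f x + g x))\<^sup>2
      \<le> (\<integral>x. (cmod (f x))\<^sup>2 + (cmod (g x))\<^sup>2 + 2 * (cmod (f x) * cmod (g x)) \<partial>pi_measure \<pi>)"
    unfolding L2norm_power2
  proof (rule integral_mono)
    show "(cmod (f x + g x))\<^sup>2 \<le> (cmod (f x))\<^sup>2 + (cmod (g x))\<^sup>2 + 2 * (cmod (f x) * cmod (g x))" for x
      using power_mono[OF norm_triangle_ineq[of "f x" "g x"], of 2] by (simp add: power2_sum)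
  qed (use int L2_integrable[OF L2_add[OF f g]] in auto)
  also have "\<dots> = (L2norm \<pi> f)\<^sup>2 + (L2norm \<pi> g)\<^sup>2 + 2 * (\<integral>x. cmod (f x) * cmod (g x) \<partial>pi_measure \<pi>)"
    using int by (simp add: L2norm_power2)
  also have "\<dots> \<le> (L2norm \<pi> f + L2norm \<pi> g)\<^sup>2"
    using L2_Cauchy_Schwarz(2)[OF f g] by (simp add: power2_sum)
  finally show ?thesis by (rule power2_le_imp_le) simp
qed

lemma L2norm_split:
  assumes f: "f \<in> L2 \<pi>" and A: "A \<in> sets borel"
  shows "(L2norm \<pi> f)\<^sup>2 = (L2norm \<pi> (\<lambda>x. indicator A x * f x))\<^sup>2
    + (L2norm \<pi> (\<lambda>x. indicator (- A) x * f x))\<^sup>2"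
proof -
  have "(cmod (f x))\<^sup>2 = (cmod (indicator A x * f x))\<^sup>2 + (cmod (indicator (- A) x * f x))\<^sup>2" for x
    by (simp add: indicator_def)
  then have "(L2norm \<pi> f)\<^sup>2
      = (\<integral>x. (cmod (indicator A x * f x))\<^sup>2 + (cmod (indicator (- A) x * f x))\<^sup>2 \<partial>pi_measure \<pi>)"
    unfolding L2norm_power2 by presburger
  also have "\<dots> = (L2norm \<pi> (\<lambda>x. indicator A x * f x))\<^sup>2 + (L2norm \<pi> (\<lambda>x. indicator (- A) x * f x))\<^sup>2"
    unfolding L2norm_power2
    by (intro Bochner_Integration.integral_add L2_integrable L2_indicator_mult f A borel_comp)
  finally show ?thesis .
qed

lemma L2norm_le_blockwise:
  assumes f: "f \<in> L2 \<pi>" and g: "g \<in> L2 \<pi>" and A: "A \<in> sets borel" and "c \<ge> 0"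
    and "L2norm \<pi> (\<lambda>x. indicator A x * g x) \<le> c * L2norm \<pi> (\<lambda>x. indicator A x * f x)"
    and "L2norm \<pi> (\<lambda>x. indicator (- A) x * g x) \<le> c * L2norm \<pi> (\<lambda>x. indicator (- A) x * f x)"
  shows "L2norm \<pi> g \<le> c * L2norm \<pi> f"
proof -
  have "(L2norm \<pi> g)\<^sup>2 \<le> (c * L2norm \<pi> (\<lambda>x. indicator A x * f x))\<^sup>2
      + (c * L2norm \<pi> (\<lambda>x. indicator (- A) x * f x))\<^sup>2"
    unfolding L2norm_split[OF g A] by (intro add_mono power_mono assms) auto
  also have "\<dots> = (c * L2norm \<pi> f)\<^sup>2"
    unfolding power_mult_distrib L2norm_split[OF f A] by (simp add: distrib_left)
  finally show ?thesis by (rule power2_le_imp_le) (simp add: \<open>c \<ge> 0\<close>)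
qed

definition L2_Cauchy :: "(real \<Rightarrow> real) \<Rightarrow> (nat \<Rightarrow> real \<Rightarrow> complex) \<Rightarrow> bool" where
  "L2_Cauchy \<pi> gs \<longleftrightarrow> (\<forall>e>0. \<exists>N. \<forall>m\<ge>N. \<forall>n\<ge>N. L2norm \<pi> (\<lambda>x. gs m x - gs n x) < e)"

lemma L2_CauchyD:
  assumes "L2_Cauchy \<pi> gs" "e > 0"
  obtains N where "\<And>m n. m \<ge> N \<Longrightarrow> n \<ge> N \<Longrightarrow> L2norm \<pi> (\<lambda>x. gs m x - gs n x) < e"
  using assms unfolding L2_Cauchy_def by blast

lemma L2_CauchyI:
  assumes "\<And>e. e > 0 \<Longrightarrow> \<exists>N. \<forall>m\<ge>N. \<forall>n\<ge>N. L2norm \<pi> (\<lambda>x. gs m x - gs n x) < e"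
  shows "L2_Cauchy \<pi> gs"
  using assms by (simp add: L2_Cauchy_def)

lemma L2_Cauchy_subseq:
  assumes "L2_Cauchy \<pi> gs" "strict_mono \<phi>"
  shows "L2_Cauchy \<pi> (\<lambda>n. gs (\<phi> n))"
proof (rule L2_CauchyI)
  fix e :: real assume "e > 0"
  then obtain N where "\<And>m n. m \<ge> N \<Longrightarrow> n \<ge> N \<Longrightarrow> L2norm \<pi> (\<lambda>x. gs m x - gs n x) < e"
    using L2_CauchyD[OF assms(1)] by blast
  then show "\<exists>N. \<forall>m\<ge>N. \<forall>n\<ge>N. L2norm \<pi> (\<lambda>x. gs (\<phi> m) x - gs (\<phi> n) x) < e"
    using seq_suble[OF assms(2)] order_trans by blast
qed

lemma L2_Cauchy_dominated:
  assumes "L2_Cauchy \<pi> gs" "C > 0"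
    and dom: "\<And>m n. L2norm \<pi> (\<lambda>x. hs m x - hs n x) \<le> C * L2norm \<pi> (\<lambda>x. gs m x - gs n x)"
  shows "L2_Cauchy \<pi> hs"
proof (rule L2_CauchyI)
  fix e :: real assume "e > 0"
  then obtain N where N: "\<And>m n. m \<ge> N \<Longrightarrow> n \<ge> N \<Longrightarrow> L2norm \<pi> (\<lambda>x. gs m x - gs n x) < e / C"
    using L2_CauchyD[OF assms(1)] \<open>C > 0\<close> by (metis divide_pos_pos)
  have "L2norm \<pi> (\<lambda>x. hs m x - hs n x) < e" if "m \<ge> N" "n \<ge> N" for m n
    using dom[of m n] N[OF that] \<open>C > 0\<close> by (simp add: field_simps)
  then show "\<exists>N. \<forall>m\<ge>N. \<forall>n\<ge>N. L2norm \<pi> (\<lambda>x. hs m x - hs n x) < e" by blast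
qed

lemma L2_Cauchy_add:
  assumes gs: "\<And>n. gs n \<in> L2 \<pi>" "L2_Cauchy \<pi> gs" and hs: "\<And>n. hs n \<in> L2 \<pi>" "L2_Cauchy \<pi> hs"
  shows "L2_Cauchy \<pi> (\<lambda>n x. gs n x + hs n x)"
proof (rule L2_CauchyI)
  fix e :: real assume "e > 0"
  then have "e / 2 > 0" by simp
  obtain N1 where N1: "\<And>m n. m \<ge> N1 \<Longrightarrow> n \<ge> N1 \<Longrightarrow> L2norm \<pi> (\<lambda>x. gs m x - gs n x) < e / 2"
    using L2_CauchyD[OF gs(2) \<open>e / 2 > 0\<close>] by blast
  obtain N2 where N2: "\<And>m n. m \<ge> N2 \<Longrightarrow> n \<ge> N2 \<Longrightarrow> L2norm \<pi> (\<lambda>x. hs m x - hs n x) < e / 2"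
    using L2_CauchyD[OF hs(2) \<open>e / 2 > 0\<close>] by blast
  have "L2norm \<pi> (\<lambda>x. (gs m x + hs m x) - (gs n x + hs n x)) < e"
    if "m \<ge> max N1 N2" "n \<ge> max N1 N2" for m n
  proof -
    have "L2norm \<pi> (\<lambda>x. (gs m x + hs m x) - (gs n x + hs n x))
        \<le> L2norm \<pi> (\<lambda>x. gs m x - gs n x) + L2norm \<pi> (\<lambda>x. hs m x - hs n x)"
      using L2norm_triangle[OF L2_diff[OF gs(1) gs(1)] L2_diff[OF hs(1) hs(1)], of m n m n]
      by (simp add: algebra_simps)
    also have "\<dots> < e" using N1[of m n] N2[of m n] that by simp
    finally show ?thesis .
  qed
  then show "\<exists>N. \<forall>m\<ge>N. \<forall>n\<ge>N. L2norm \<pi> (\<lambda>x. (gs m x + hs m x) - (gs n x + hs n x)) < e"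
    by blast
qed

lemma L2_Cauchy_imp_Bseq:
  assumes gs: "\<And>n. gs n \<in> L2 \<pi>" and cauchy: "L2_Cauchy \<pi> gs"
  shows "Bseq (\<lambda>n. L2norm \<pi> (gs n))"
proof -
  obtain N where N: "\<And>m n. m \<ge> N \<Longrightarrow> n \<ge> N \<Longrightarrow> L2norm \<pi> (\<lambda>x. gs m x - gs n x) < 1"
    using L2_CauchyD[OF cauchy zero_less_one] by blast
  have "L2norm \<pi> (gs n) \<le> 1 + L2norm \<pi> (gs N)" if "n \<ge> N" for n
    using L2norm_triangle[OF L2_diff[OF gs gs] gs, of n N N] N[OF that order_refl] by simp
  then have "\<forall>\<^sub>F n in sequentially. norm (L2norm \<pi> (gs n)) \<le> 1 + L2norm \<pi> (gs N)"
    by (intro eventually_sequentiallyI[of N]) simp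
  then show ?thesis by (rule BfunI)
qed

section \<open>Bounded and compact operators on \<open>L\<^sup>2(\<pi>)\<close>\<close>

definition L2_linear_op :: "(real \<Rightarrow> real) \<Rightarrow> ((real \<Rightarrow> complex) \<Rightarrow> (real \<Rightarrow> complex)) \<Rightarrow> bool" where
  "L2_linear_op \<pi> S \<longleftrightarrow> (\<forall>f\<in>L2 \<pi>. S f \<in> L2 \<pi>) \<and>
     (\<forall>f\<in>L2 \<pi>. \<forall>g\<in>L2 \<pi>. \<forall>c::complex.
        AE x in pi_measure \<pi>. S (\<lambda>y. c * f y + g y) x = c * S f x + S g x)"

definition L2_bounded_op :: "(real \<Rightarrow> real) \<Rightarrow> ((real \<Rightarrow> complex) \<Rightarrow> (real \<Rightarrow> complex)) \<Rightarrow> bool" where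
  "L2_bounded_op \<pi> S \<longleftrightarrow> L2_linear_op \<pi> S \<and>
     (\<exists>C. \<forall>f\<in>L2 \<pi>. L2norm \<pi> (S f) \<le> C * L2norm \<pi> f)"

lemma L2_linear_opI:
  assumes "\<And>f. f \<in> L2 \<pi> \<Longrightarrow> S f \<in> L2 \<pi>"
    and "\<And>f g c. f \<in> L2 \<pi> \<Longrightarrow> g \<in> L2 \<pi> \<Longrightarrow>
      AE x in pi_measure \<pi>. S (\<lambda>y. c * f y + g y) x = c * S f x + S g x"
  shows "L2_linear_op \<pi> S"
  using assms by (simp add: L2_linear_op_def)

lemma L2_linear_op_in: "L2_linear_op \<pi> S \<Longrightarrow> f \<in> L2 \<pi> \<Longrightarrow> S f \<in> L2 \<pi>"
  by (simp add: L2_linear_op_def)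

lemma L2_linear_op_lincomb:
  "L2_linear_op \<pi> S \<Longrightarrow> f \<in> L2 \<pi> \<Longrightarrow> g \<in> L2 \<pi> \<Longrightarrow>
     AE x in pi_measure \<pi>. S (\<lambda>y. c * f y + g y) x = c * S f x + S g x"
  by (simp add: L2_linear_op_def)

lemma L2_linear_op_diff:
  assumes "L2_linear_op \<pi> S" "f \<in> L2 \<pi>" "g \<in> L2 \<pi>"
  shows "AE x in pi_measure \<pi>. S (\<lambda>y. f y - g y) x = S f x - S g x"
  using L2_linear_op_lincomb[OF assms(1,3,2), of "-1"] by simp

lemma L2norm_linear_op_diff:
  assumes S: "L2_linear_op \<pi> S" and fg: "f \<in> L2 \<pi>" "g \<in> L2 \<pi>"
  shows "L2norm \<pi> (\<lambda>x. S f x - S g x) = L2norm \<pi> (S (\<lambda>x. f x - g x))"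
  using L2_linear_op_diff[OF S fg]
  by (intro L2norm_cong_AE L2_diff L2_linear_op_in[OF S] fg) auto

lemma L2_linear_op_cmult:
  assumes "L2_linear_op \<pi> S" "f \<in> L2 \<pi>"
  shows "AE x in pi_measure \<pi>. S (\<lambda>y. c * f y) x = c * S f x"
proof -
  have "AE x in pi_measure \<pi>. S (\<lambda>y. 0) x = 0"
    using L2_linear_op_diff[OF assms assms(2)] by simp
  with L2_linear_op_lincomb[OF assms L2_zero, of c] show ?thesis by auto
qed

lemma L2norm_linear_op_cmult:
  assumes S: "L2_linear_op \<pi> S" and f: "f \<in> L2 \<pi>"
  shows "L2norm \<pi> (S (\<lambda>x. c * f x)) = cmod c * L2norm \<pi> (S f)"
proof -
  have "L2norm \<pi> (S (\<lambda>x. c * f x)) = L2norm \<pi> (\<lambda>x. c * S f x)"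
    by (intro L2norm_cong_AE L2_linear_op_in[OF S] L2_cmult L2_linear_op_cmult[OF S] f)
  then show ?thesis by (simp add: L2norm_cmult)
qed

lemma isCont_le_of_right:
  fixes F :: "real \<Rightarrow> real"
  assumes "isCont F a" "\<And>x. x > a \<Longrightarrow> c \<le> F x"
  shows "c \<le> F a"
proof (rule tendsto_lowerbound)
  show "(F \<longlongrightarrow> F a) (at_right a)"
    using assms(1) by (simp add: isCont_def filterlim_at_split)
  show "\<forall>\<^sub>F x in at_right a. c \<le> F x"
    using assms(2) by (simp add: eventually_at_filter)
qed simp

lemma L2norm_linear_op_le_of_unit_ball:
  assumes S: "L2_linear_op \<pi> S" and f: "f \<in> L2 \<pi>"
    and ball: "\<And>f. f \<in> L2 \<pi> \<Longrightarrow> L2norm \<pi> f \<le> 1 \<Longrightarrow> L2norm \<pi> (S f) \<le> B"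
  shows "L2norm \<pi> (S f) \<le> B * L2norm \<pi> f"
proof -
  have "L2norm \<pi> (S f) \<le> B * (L2norm \<pi> f + e)" if "e > 0" for e
  proof -
    define c where "c = L2norm \<pi> f + e"
    have "c > 0" using that by (simp add: c_def add_nonneg_pos)
    have "1 / c * L2norm \<pi> (S f) = L2norm \<pi> (S (\<lambda>x. complex_of_real (1 / c) * f x))"
      using \<open>c > 0\<close> by (subst L2norm_linear_op_cmult[OF S f]) (simp add: norm_divide)
    also have "\<dots> \<le> B"
    proof (intro ball L2_cmult f)
      show "L2norm \<pi> (\<lambda>x. complex_of_real (1 / c) * f x) \<le> 1"
        using \<open>c > 0\<close> that by (subst L2norm_scale_nonneg) (auto simp: c_def)
    qed
    finally have "L2norm \<pi> (S f) \<le> B * c" using \<open>c > 0\<close> by (simp add: field_simps)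
    then show ?thesis by (simp add: c_def)
  qed
  then show ?thesis
    using isCont_le_of_right[of 0 "\<lambda>e. B * (L2norm \<pi> f + e)"] by simp
qed

lemma L2_bounded_op_linear: "L2_bounded_op \<pi> S \<Longrightarrow> L2_linear_op \<pi> S"
  by (simp add: L2_bounded_op_def)

lemma L2_bounded_op_in: "L2_bounded_op \<pi> S \<Longrightarrow> f \<in> L2 \<pi> \<Longrightarrow> S f \<in> L2 \<pi>"
  by (simp add: L2_bounded_op_def L2_linear_op_def)

lemma L2_bounded_opI:
  assumes "L2_linear_op \<pi> S" "\<And>f. f \<in> L2 \<pi> \<Longrightarrow> L2norm \<pi> (S f) \<le> C * L2norm \<pi> f"
  shows "L2_bounded_op \<pi> S"
  using assms by (auto simp: L2_bounded_op_def)

lemma L2_bounded_opE: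
  assumes "L2_bounded_op \<pi> S"
  obtains C where "C > 0" "\<And>f. f \<in> L2 \<pi> \<Longrightarrow> L2norm \<pi> (S f) \<le> C * L2norm \<pi> f"
proof -
  obtain C where C: "\<And>f. f \<in> L2 \<pi> \<Longrightarrow> L2norm \<pi> (S f) \<le> C * L2norm \<pi> f"
    using assms by (auto simp: L2_bounded_op_def)
  have "L2norm \<pi> (S f) \<le> max C 1 * L2norm \<pi> f" if "f \<in> L2 \<pi>" for f
    by (rule order_trans[OF C[OF that] mult_right_mono]) auto
  then show thesis using that[of "max C 1"] by simp
qed

lemma L2_bounded_op_unit_ballE:
  assumes "L2_bounded_op \<pi> S"
  obtains C where "\<And>f. f \<in> L2 \<pi> \<Longrightarrow> L2norm \<pi> f \<le> 1 \<Longrightarrow> L2norm \<pi> (S f) \<le> C"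
proof -
  obtain C where C: "C > 0" "\<And>f. f \<in> L2 \<pi> \<Longrightarrow> L2norm \<pi> (S f) \<le> C * L2norm \<pi> f"
    using L2_bounded_opE[OF assms] by blast
  have "L2norm \<pi> (S f) \<le> C" if "f \<in> L2 \<pi>" "L2norm \<pi> f \<le> 1" for f
    using C(2)[OF that(1)] mult_left_mono[OF that(2), of C] C(1) by linarith
  then show thesis by (rule that)
qed

lemma L2_bounded_op_cong_AE:
  assumes S: "L2_bounded_op \<pi> S" and fg: "f \<in> L2 \<pi>" "g \<in> L2 \<pi>"
    and eq: "AE x in pi_measure \<pi>. f x = g x"
  shows "AE x in pi_measure \<pi>. S f x = S g x"
proof -
  obtain C where C: "\<And>f. f \<in> L2 \<pi> \<Longrightarrow> L2norm \<pi> (S f) \<le> C * L2norm \<pi> f"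
    using L2_bounded_opE[OF S] by blast
  have "L2norm \<pi> (\<lambda>x. f x - g x) = 0"
    using L2norm_cong_AE[OF L2_diff[OF fg] L2_zero] eq by simp
  then have "L2norm \<pi> (S (\<lambda>x. f x - g x)) = 0"
    using C[OF L2_diff[OF fg]] by (simp add: order_antisym)
  then have "AE x in pi_measure \<pi>. S (\<lambda>x. f x - g x) x = 0"
    by (intro L2norm_eq_0_imp_AE L2_bounded_op_in[OF S] L2_diff fg)
  with L2_linear_op_diff[OF L2_bounded_op_linear[OF S] fg] show ?thesis by auto
qed

lemma L2_bounded_op_id: "L2_bounded_op \<pi> (\<lambda>f. f)"
  by (intro L2_bounded_opI[where C = 1] L2_linear_opI) auto

lemma L2_linear_op_comp:
  assumes S: "L2_bounded_op \<pi> S" and T: "L2_linear_op \<pi> T"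
  shows "L2_linear_op \<pi> (\<lambda>f. S (T f))"
proof (rule L2_linear_opI)
  fix f g c assume f: "f \<in> L2 \<pi>" and g: "g \<in> L2 \<pi>"
  have "AE x in pi_measure \<pi>. S (T (\<lambda>y. c * f y + g y)) x = S (\<lambda>y. c * T f y + T g y) x"
    by (intro L2_bounded_op_cong_AE[OF S] L2_lincomb L2_linear_op_in[OF T]
        L2_linear_op_lincomb[OF T] f g)
  moreover have "AE x in pi_measure \<pi>. S (\<lambda>y. c * T f y + T g y) x = c * S (T f) x + S (T g) x"
    by (intro L2_linear_op_lincomb L2_bounded_op_linear[OF S] L2_linear_op_in[OF T] f g)
  ultimately show "AE x in pi_measure \<pi>. S (T (\<lambda>y. c * f y + g y)) x = c * S (T f) x + S (T g) x"
    by eventually_elim simp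
qed (intro L2_bounded_op_in[OF S] L2_linear_op_in[OF T])

lemma L2_bounded_op_comp:
  assumes S: "L2_bounded_op \<pi> S" and T: "L2_bounded_op \<pi> T"
  shows "L2_bounded_op \<pi> (\<lambda>f. S (T f))"
proof -
  obtain C where C: "C > 0" "\<And>f. f \<in> L2 \<pi> \<Longrightarrow> L2norm \<pi> (S f) \<le> C * L2norm \<pi> f"
    using L2_bounded_opE[OF S] by blast
  obtain D where D: "\<And>f. f \<in> L2 \<pi> \<Longrightarrow> L2norm \<pi> (T f) \<le> D * L2norm \<pi> f"
    using L2_bounded_opE[OF T] by blast
  show ?thesis
  proof (rule L2_bounded_opI[OF L2_linear_op_comp[OF S L2_bounded_op_linear[OF T]]])
    fix f assume f: "f \<in> L2 \<pi>"
    have "L2norm \<pi> (S (T f)) \<le> C * L2norm \<pi> (T f)"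
      by (intro C L2_bounded_op_in[OF T] f)
    also have "\<dots> \<le> C * (D * L2norm \<pi> f)" using C(1) D[OF f] by simp
    finally show "L2norm \<pi> (S (T f)) \<le> C * D * L2norm \<pi> f" by (simp add: mult.assoc)
  qed
qed

lemma L2_linear_op_lincomb_op:
  assumes S: "L2_linear_op \<pi> S" and T: "L2_linear_op \<pi> T"
  shows "L2_linear_op \<pi> (\<lambda>f x. d * S f x + T f x)"
proof (rule L2_linear_opI)
  fix f g c assume f: "f \<in> L2 \<pi>" and g: "g \<in> L2 \<pi>"
  show "AE x in pi_measure \<pi>. d * S (\<lambda>y. c * f y + g y) x + T (\<lambda>y. c * f y + g y) x
      = c * (d * S f x + T f x) + (d * S g x + T g x)"
    using L2_linear_op_lincomb[OF S f g, of c] L2_linear_op_lincomb[OF T f g, of c]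
    by eventually_elim (simp add: algebra_simps)
qed (intro L2_lincomb L2_linear_op_in[OF S] L2_linear_op_in[OF T])

lemma L2_bounded_op_lincomb:
  assumes S: "L2_bounded_op \<pi> S" and T: "L2_bounded_op \<pi> T"
  shows "L2_bounded_op \<pi> (\<lambda>f x. d * S f x + T f x)"
proof -
  obtain C where C: "\<And>f. f \<in> L2 \<pi> \<Longrightarrow> L2norm \<pi> (S f) \<le> C * L2norm \<pi> f"
    using L2_bounded_opE[OF S] by blast
  obtain D where D: "\<And>f. f \<in> L2 \<pi> \<Longrightarrow> L2norm \<pi> (T f) \<le> D * L2norm \<pi> f"
    using L2_bounded_opE[OF T] by blast
  show ?thesis
  proof (rule L2_bounded_opI[OF L2_linear_op_lincomb_op[OF S[THEN L2_bounded_op_linear]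
          T[THEN L2_bounded_op_linear]]])
    fix f assume f: "f \<in> L2 \<pi>"
    have "L2norm \<pi> (\<lambda>x. d * S f x + T f x) \<le> cmod d * L2norm \<pi> (S f) + L2norm \<pi> (T f)"
      using L2norm_triangle[OF L2_cmult[OF L2_bounded_op_in[OF S f]] L2_bounded_op_in[OF T f]]
      by (simp add: L2norm_cmult)
    also have "\<dots> \<le> cmod d * (C * L2norm \<pi> f) + D * L2norm \<pi> f"
      by (intro add_mono mult_left_mono C D f) auto
    finally show "L2norm \<pi> (\<lambda>x. d * S f x + T f x) \<le> (cmod d * C + D) * L2norm \<pi> f"
      by (simp add: algebra_simps)
  qed
qed

lemma L2_bounded_op_diff:
  "L2_bounded_op \<pi> S \<Longrightarrow> L2_bounded_op \<pi> T \<Longrightarrow> L2_bounded_op \<pi> (\<lambda>f x. S f x - T f x)"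
  using L2_bounded_op_lincomb[of \<pi> T S "-1"] by simp

lemma L2_bounded_op_add:
  "L2_bounded_op \<pi> S \<Longrightarrow> L2_bounded_op \<pi> T \<Longrightarrow> L2_bounded_op \<pi> (\<lambda>f x. S f x + T f x)"
  using L2_bounded_op_lincomb[of \<pi> S T 1] by simp

lemma L2_bounded_op_funpow: "L2_bounded_op \<pi> T \<Longrightarrow> L2_bounded_op \<pi> (T ^^ n)"
proof (induction n)
  case 0
  then show ?case using L2_bounded_op_id by (simp add: id_def)
next
  case (Suc n)
  then show ?case using L2_bounded_op_comp[of \<pi> T "T ^^ n"] by (simp add: comp_def)
qed

lemma L2_bounded_op_mult:
  assumes "h \<in> borel_measurable borel" "\<And>x. cmod (h x) \<le> C"
  shows "L2_bounded_op \<pi> (\<lambda>f x. h x * f x)"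
proof (intro L2_bounded_opI L2_linear_opI)
  fix f assume f: "f \<in> L2 \<pi>"
  show "(\<lambda>x. h x * f x) \<in> L2 \<pi>" by (rule L2_mult_bounded[OF f assms])
  have "C \<ge> 0" using assms(2)[of 0] norm_ge_zero order_trans by blast
  show "L2norm \<pi> (\<lambda>x. h x * f x) \<le> C * L2norm \<pi> f"
    using assms(2) by (intro L2norm_le_cmult f L2_mult_bounded[OF f assms] \<open>C \<ge> 0\<close>)
      (simp add: norm_mult mult_right_mono)
qed (simp add: distrib_left mult.left_commute)

lemma L2_bounded_op_indicator:
  "A \<in> sets borel \<Longrightarrow> L2_bounded_op \<pi> (\<lambda>f x. indicator A x * f x)"
  by (rule L2_bounded_op_mult[where C = 1]) (auto simp: indicator_def)

lemma L2_compact_op_iff: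
  "L2_compact_op \<pi> K \<longleftrightarrow> L2_linear_op \<pi> K \<and>
     (\<forall>fs::nat \<Rightarrow> real \<Rightarrow> complex. (\<forall>n. fs n \<in> L2 \<pi> \<and> L2norm \<pi> (fs n) \<le> 1) \<longrightarrow>
        (\<exists>\<phi>. strict_mono \<phi> \<and> L2_Cauchy \<pi> (\<lambda>n. K (fs (\<phi> n)))))"
  unfolding L2_compact_op_def L2_linear_op_def L2_Cauchy_def by blast

lemma L2_compact_op_linear: "L2_compact_op \<pi> K \<Longrightarrow> L2_linear_op \<pi> K"
  by (simp add: L2_compact_op_iff)

lemma L2_compact_op_in: "L2_compact_op \<pi> K \<Longrightarrow> f \<in> L2 \<pi> \<Longrightarrow> K f \<in> L2 \<pi>"
  by (simp add: L2_compact_op_def)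

lemma L2_compact_opI:
  assumes "L2_linear_op \<pi> K"
    and "\<And>fs :: nat \<Rightarrow> real \<Rightarrow> complex. (\<And>n. fs n \<in> L2 \<pi>) \<Longrightarrow> (\<And>n. L2norm \<pi> (fs n) \<le> 1) \<Longrightarrow>
      \<exists>\<phi>. strict_mono \<phi> \<and> L2_Cauchy \<pi> (\<lambda>n. K (fs (\<phi> n)))"
  shows "L2_compact_op \<pi> K"
  using assms by (simp add: L2_compact_op_iff)

lemma L2_compact_op_Cauchy_subseq:
  assumes K: "L2_compact_op \<pi> K" and fs: "\<And>n::nat. fs n \<in> L2 \<pi>" "\<And>n. L2norm \<pi> (fs n) \<le> C"
  obtains \<phi> :: "nat \<Rightarrow> nat" where "strict_mono \<phi>" "L2_Cauchy \<pi> (\<lambda>n. K (fs (\<phi> n)))"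
proof -
  note lin = L2_compact_op_linear[OF K]
  define D where "D = max C 1"
  have "D > 0" "C \<le> D" by (simp_all add: D_def)
  define gs where "gs n = (\<lambda>x. complex_of_real (1 / D) * fs n x)" for n
  have gs: "gs n \<in> L2 \<pi>" for n
    unfolding gs_def by (intro L2_cmult fs)
  moreover have "L2norm \<pi> (gs n) \<le> 1" for n
    unfolding gs_def using \<open>D > 0\<close> order_trans[OF fs(2) \<open>C \<le> D\<close>]
    by (subst L2norm_scale_nonneg) auto
  ultimately obtain \<phi> :: "nat \<Rightarrow> nat" where \<phi>: "strict_mono \<phi>" "L2_Cauchy \<pi> (\<lambda>n. K (gs (\<phi> n)))"
    using K unfolding L2_compact_op_iff by metis
  have Kfs: "AE x in pi_measure \<pi>. K (gs n) x = complex_of_real (1 / D) * K (fs n) x" for n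
    unfolding gs_def by (intro L2_linear_op_cmult[OF lin] fs)
  have "L2norm \<pi> (\<lambda>x. K (fs m) x - K (fs n) x)
      = L2norm \<pi> (\<lambda>x. complex_of_real D * (K (gs m) x - K (gs n) x))" for m n
    using Kfs[of m] Kfs[of n] \<open>D > 0\<close>
    by (intro L2norm_cong_AE L2_diff L2_cmult L2_compact_op_in[OF K] fs gs)
      (auto simp: algebra_simps)
  then have "L2norm \<pi> (\<lambda>x. K (fs m) x - K (fs n) x) = D * L2norm \<pi> (\<lambda>x. K (gs m) x - K (gs n) x)" for m n
    using \<open>D > 0\<close> by (simp add: L2norm_scale_nonneg)
  then have "L2_Cauchy \<pi> (\<lambda>n. K (fs (\<phi> n)))"
    by (intro L2_Cauchy_dominated[OF \<phi>(2) \<open>D > 0\<close>]) simp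
  with \<phi>(1) show thesis by (rule that)
qed

lemma L2_compact_op_bounded:
  assumes K: "L2_compact_op \<pi> K"
  shows "L2_bounded_op \<pi> K"
proof -
  note lin = L2_compact_op_linear[OF K]
  have "\<exists>B. \<forall>f\<in>L2 \<pi>. L2norm \<pi> f \<le> 1 \<longrightarrow> L2norm \<pi> (K f) \<le> B"
  proof (rule ccontr)
    assume "\<not> ?thesis"
    then have "\<forall>n::nat. \<exists>f. f \<in> L2 \<pi> \<and> L2norm \<pi> f \<le> 1 \<and> L2norm \<pi> (K f) > real n"
      by (metis not_less)
    then obtain fs where fs: "\<And>n::nat. fs n \<in> L2 \<pi>" "\<And>n. L2norm \<pi> (fs n) \<le> 1"
      and large: "\<And>n. L2norm \<pi> (K (fs n)) > real n"
      by metis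
    obtain \<phi> :: "nat \<Rightarrow> nat" where \<phi>: "strict_mono \<phi>" "L2_Cauchy \<pi> (\<lambda>n. K (fs (\<phi> n)))"
      using L2_compact_op_Cauchy_subseq[of \<pi> K fs, OF K fs] by blast
    obtain B where B: "\<And>n. L2norm \<pi> (K (fs (\<phi> n))) \<le> B"
      using BseqD[OF L2_Cauchy_imp_Bseq[OF L2_compact_op_in[OF K fs(1)] \<phi>(2)]] by auto
    obtain n :: nat where "real n > B" using reals_Archimedean2 by blast
    moreover have "real n \<le> real (\<phi> n)" using seq_suble[OF \<phi>(1)] by simp
    ultimately show False using large[of "\<phi> n"] B[of n] by linarith
  qed
  then show ?thesis
    using L2norm_linear_op_le_of_unit_ball[OF lin] L2_bounded_opI[OF lin] by metis
qed

lemma L2_compact_op_comp_left: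
  assumes S: "L2_bounded_op \<pi> S" and K: "L2_compact_op \<pi> K"
  shows "L2_compact_op \<pi> (\<lambda>f. S (K f))"
proof (rule L2_compact_opI)
  show "L2_linear_op \<pi> (\<lambda>f. S (K f))"
    by (rule L2_linear_op_comp[OF S L2_compact_op_linear[OF K]])
  obtain C where C: "C > 0" "\<And>f. f \<in> L2 \<pi> \<Longrightarrow> L2norm \<pi> (S f) \<le> C * L2norm \<pi> f"
    using L2_bounded_opE[OF S] by blast
  fix fs :: "nat \<Rightarrow> real \<Rightarrow> complex"
  assume fs: "\<And>n. fs n \<in> L2 \<pi>" "\<And>n. L2norm \<pi> (fs n) \<le> 1"
  note Kfs = L2_compact_op_in[OF K fs(1)]
  obtain \<phi> :: "nat \<Rightarrow> nat" where \<phi>: "strict_mono \<phi>" "L2_Cauchy \<pi> (\<lambda>n. K (fs (\<phi> n)))"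
    using L2_compact_op_Cauchy_subseq[of \<pi> K fs, OF K fs] by blast
  have "L2norm \<pi> (\<lambda>x. S (K (fs m)) x - S (K (fs n)) x)
      \<le> C * L2norm \<pi> (\<lambda>x. K (fs m) x - K (fs n) x)" for m n
    unfolding L2norm_linear_op_diff[OF L2_bounded_op_linear[OF S] Kfs Kfs]
    by (intro C L2_diff Kfs)
  then show "\<exists>\<phi>. strict_mono \<phi> \<and> L2_Cauchy \<pi> (\<lambda>n. S (K (fs (\<phi> n))))"
    using \<phi>(1) L2_Cauchy_dominated[OF \<phi>(2) C(1), of "\<lambda>n. S (K (fs (\<phi> n)))"] by blast
qed

lemma L2_compact_op_comp_right:
  assumes K: "L2_compact_op \<pi> K" and S: "L2_bounded_op \<pi> S"
  shows "L2_compact_op \<pi> (\<lambda>f. K (S f))"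
proof (rule L2_compact_opI)
  show "L2_linear_op \<pi> (\<lambda>f. K (S f))"
    by (rule L2_linear_op_comp[OF L2_compact_op_bounded[OF K] L2_bounded_op_linear[OF S]])
  obtain C where C: "\<And>f. f \<in> L2 \<pi> \<Longrightarrow> L2norm \<pi> f \<le> 1 \<Longrightarrow> L2norm \<pi> (S f) \<le> C"
    using L2_bounded_op_unit_ballE[OF S] by blast
  fix fs :: "nat \<Rightarrow> real \<Rightarrow> complex"
  assume fs: "\<And>n. fs n \<in> L2 \<pi>" "\<And>n. L2norm \<pi> (fs n) \<le> 1"
  have "L2norm \<pi> (S (fs n)) \<le> C" for n by (rule C[OF fs])
  then show "\<exists>\<phi>. strict_mono \<phi> \<and> L2_Cauchy \<pi> (\<lambda>n. K (S (fs (\<phi> n))))"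
    using L2_compact_op_Cauchy_subseq[of \<pi> K "\<lambda>n. S (fs n)", OF K L2_bounded_op_in[OF S fs(1)]] by metis
qed

lemma L2_compact_op_add:
  assumes K: "L2_compact_op \<pi> K" and L: "L2_compact_op \<pi> L"
  shows "L2_compact_op \<pi> (\<lambda>f x. K f x + L f x)"
proof (rule L2_compact_opI)
  show "L2_linear_op \<pi> (\<lambda>f x. K f x + L f x)"
    using L2_linear_op_lincomb_op[OF K[THEN L2_compact_op_linear] L[THEN L2_compact_op_linear], of 1]
    by simp
  fix fs :: "nat \<Rightarrow> real \<Rightarrow> complex"
  assume fs: "\<And>n. fs n \<in> L2 \<pi>" "\<And>n. L2norm \<pi> (fs n) \<le> 1"
  obtain \<phi> :: "nat \<Rightarrow> nat" where \<phi>: "strict_mono \<phi>" "L2_Cauchy \<pi> (\<lambda>n. K (fs (\<phi> n)))"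
    using L2_compact_op_Cauchy_subseq[of \<pi> K fs, OF K fs] by blast
  obtain \<psi> :: "nat \<Rightarrow> nat" where \<psi>: "strict_mono \<psi>" "L2_Cauchy \<pi> (\<lambda>n. L (fs (\<phi> (\<psi> n))))"
    using L2_compact_op_Cauchy_subseq[of \<pi> L "\<lambda>n. fs (\<phi> n)", OF L fs] by blast
  have "L2_Cauchy \<pi> (\<lambda>n x. K (fs (\<phi> (\<psi> n))) x + L (fs (\<phi> (\<psi> n))) x)"
    by (intro L2_Cauchy_add L2_Cauchy_subseq[OF \<phi>(2) \<psi>(1)] \<psi>(2)
        L2_compact_op_in[OF K] L2_compact_op_in[OF L] fs)
  then show "\<exists>\<phi>. strict_mono \<phi> \<and> L2_Cauchy \<pi> (\<lambda>n x. K (fs (\<phi> n)) x + L (fs (\<phi> n)) x)"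
    using strict_mono_o[OF \<phi>(1) \<psi>(1)] by (intro exI[of _ "\<phi> \<circ> \<psi>"]) simp
qed

lemma L2_compact_op_zero: "L2_compact_op \<pi> (\<lambda>f x. 0)"
  by (intro L2_compact_opI L2_linear_opI)
    (auto simp: L2_zero L2_Cauchy_def intro: exI[of _ id] strict_mono_id)

section \<open>The essential norm and the essential spectral radius\<close>

lemma L2_opnorm_bdd_above:
  assumes "L2_bounded_op \<pi> S"
  shows "bdd_above ((\<lambda>f. L2norm \<pi> (S f)) ` {f \<in> L2 \<pi>. L2norm \<pi> f \<le> 1})"
proof -
  obtain C where "\<And>f. f \<in> L2 \<pi> \<Longrightarrow> L2norm \<pi> f \<le> 1 \<Longrightarrow> L2norm \<pi> (S f) \<le> C"
    using L2_bounded_op_unit_ballE[OF assms] by blast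
  then show ?thesis by (auto intro!: bdd_aboveI2)
qed

lemma L2_opnorm_nonneg: "L2_bounded_op \<pi> S \<Longrightarrow> L2_opnorm \<pi> S \<ge> 0"
  unfolding L2_opnorm_def
  by (rule cSUP_upper2[OF L2_opnorm_bdd_above, of _ _ "\<lambda>_. 0"]) (auto simp: L2_zero)

lemma L2norm_le_opnorm:
  assumes S: "L2_bounded_op \<pi> S" and f: "f \<in> L2 \<pi>"
  shows "L2norm \<pi> (S f) \<le> L2_opnorm \<pi> S * L2norm \<pi> f"
proof (rule L2norm_linear_op_le_of_unit_ball[OF L2_bounded_op_linear[OF S] f])
  show "L2norm \<pi> (S f) \<le> L2_opnorm \<pi> S" if "f \<in> L2 \<pi>" "L2norm \<pi> f \<le> 1" for f
    unfolding L2_opnorm_def using that by (intro cSUP_upper L2_opnorm_bdd_above S) auto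
qed

lemma L2_opnorm_le:
  assumes "C \<ge> 0" "\<And>f. f \<in> L2 \<pi> \<Longrightarrow> L2norm \<pi> (S f) \<le> C * L2norm \<pi> f"
  shows "L2_opnorm \<pi> S \<le> C"
  unfolding L2_opnorm_def
proof (rule cSUP_least)
  show "{f \<in> L2 \<pi>. L2norm \<pi> f \<le> 1} \<noteq> {}" using L2_zero by (auto intro!: exI[of _ "\<lambda>_. 0"])
  fix f assume "f \<in> {f \<in> L2 \<pi>. L2norm \<pi> f \<le> 1}"
  then show "L2norm \<pi> (S f) \<le> C"
    using assms(2)[of f] mult_left_mono[of "L2norm \<pi> f" 1 C] assms(1) by auto
qed

lemma L2_opnorm_comp_le:
  assumes S: "L2_bounded_op \<pi> S" and T: "L2_bounded_op \<pi> T"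
  shows "L2_opnorm \<pi> (\<lambda>f. S (T f)) \<le> L2_opnorm \<pi> S * L2_opnorm \<pi> T"
proof (rule L2_opnorm_le)
  show "0 \<le> L2_opnorm \<pi> S * L2_opnorm \<pi> T"
    by (intro mult_nonneg_nonneg L2_opnorm_nonneg S T)
  fix f assume f: "f \<in> L2 \<pi>"
  have "L2norm \<pi> (S (T f)) \<le> L2_opnorm \<pi> S * L2norm \<pi> (T f)"
    by (intro L2norm_le_opnorm[OF S] L2_bounded_op_in[OF T] f)
  also have "\<dots> \<le> L2_opnorm \<pi> S * (L2_opnorm \<pi> T * L2norm \<pi> f)"
    by (intro mult_left_mono L2norm_le_opnorm[OF T f] L2_opnorm_nonneg S)
  finally show "L2norm \<pi> (S (T f)) \<le> L2_opnorm \<pi> S * L2_opnorm \<pi> T * L2norm \<pi> f"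
    by (simp add: mult.assoc)
qed

lemma L2_opnorm_cong_AE:
  assumes "L2_bounded_op \<pi> S" "L2_bounded_op \<pi> T"
    and "\<And>f. f \<in> L2 \<pi> \<Longrightarrow> AE x in pi_measure \<pi>. S f x = T f x"
  shows "L2_opnorm \<pi> S = L2_opnorm \<pi> T"
  unfolding L2_opnorm_def
  by (intro SUP_cong refl L2norm_cong_AE)
    (use assms in \<open>auto intro: L2_bounded_op_in\<close>)

definition ess_norm :: "(real \<Rightarrow> real) \<Rightarrow> ((real \<Rightarrow> complex) \<Rightarrow> (real \<Rightarrow> complex)) \<Rightarrow> real" where
  "ess_norm \<pi> S = (INF K\<in>{K. L2_compact_op \<pi> K}. L2_opnorm \<pi> (\<lambda>f x. S f x - K f x))"

lemma ess_norm_bdd_below: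
  assumes "L2_bounded_op \<pi> S"
  shows "bdd_below ((\<lambda>K. L2_opnorm \<pi> (\<lambda>f x. S f x - K f x)) ` {K. L2_compact_op \<pi> K})"
  by (rule bdd_belowI2[where m = 0])
    (auto intro!: L2_opnorm_nonneg L2_bounded_op_diff assms intro: L2_compact_op_bounded)

lemma ess_norm_nonneg: "L2_bounded_op \<pi> S \<Longrightarrow> ess_norm \<pi> S \<ge> 0"
  unfolding ess_norm_def using L2_compact_op_zero
  by (intro cINF_greatest)
    (auto intro!: L2_opnorm_nonneg L2_bounded_op_diff intro: L2_compact_op_bounded)

lemma ess_norm_le:
  "L2_bounded_op \<pi> S \<Longrightarrow> L2_compact_op \<pi> K \<Longrightarrow> ess_norm \<pi> S \<le> L2_opnorm \<pi> (\<lambda>f x. S f x - K f x)"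
  unfolding ess_norm_def by (intro cINF_lower ess_norm_bdd_below) auto

lemma ess_norm_approx:
  assumes "L2_bounded_op \<pi> S" "e > 0"
  obtains K where "L2_compact_op \<pi> K" "L2_opnorm \<pi> (\<lambda>f x. S f x - K f x) < ess_norm \<pi> S + e"
proof -
  have "(INF K\<in>{K. L2_compact_op \<pi> K}. L2_opnorm \<pi> (\<lambda>f x. S f x - K f x)) < ess_norm \<pi> S + e"
    using assms(2) by (simp add: ess_norm_def)
  then show thesis
    using that L2_compact_op_zero
    by (subst (asm) cINF_less_iff) (auto intro!: ess_norm_bdd_below assms)
qed

lemma ess_norm_comp_le_opnorm_mult:
  assumes S: "L2_bounded_op \<pi> S" and T: "L2_bounded_op \<pi> T"
    and K: "L2_compact_op \<pi> K" and L: "L2_compact_op \<pi> L"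
  shows "ess_norm \<pi> (\<lambda>f. S (T f))
    \<le> L2_opnorm \<pi> (\<lambda>f x. S f x - K f x) * L2_opnorm \<pi> (\<lambda>f x. T f x - L f x)"
proof -
  define S' T' where "S' = (\<lambda>f x. S f x - K f x)" and "T' = (\<lambda>f x. T f x - L f x)"
  have S': "L2_bounded_op \<pi> S'" and T': "L2_bounded_op \<pi> T'"
    unfolding S'_def T'_def by (intro L2_bounded_op_diff S T L2_compact_op_bounded K L)+
  \<comment> \<open>\<open>S T - Q = (S - K) (T - L)\<close>\<close>
  define Q where "Q = (\<lambda>f x. S (L f) x + K (T' f) x)"
  have Q: "L2_compact_op \<pi> Q"
    unfolding Q_def
    by (intro L2_compact_op_add L2_compact_op_comp_left[OF S L] L2_compact_op_comp_right[OF K T'])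
  have ST: "L2_bounded_op \<pi> (\<lambda>f. S (T f))" by (rule L2_bounded_op_comp[OF S T])
  have eq: "AE x in pi_measure \<pi>. S (T f) x - Q f x = S' (T' f) x" if f: "f \<in> L2 \<pi>" for f
  proof -
    have "AE x in pi_measure \<pi>. S (T' f) x = S (T f) x - S (L f) x"
      unfolding T'_def
      by (intro L2_linear_op_diff L2_bounded_op_linear[OF S] L2_bounded_op_in[OF T]
          L2_compact_op_in[OF L] f)
    then show ?thesis by eventually_elim (simp add: Q_def S'_def)
  qed
  have "ess_norm \<pi> (\<lambda>f. S (T f)) \<le> L2_opnorm \<pi> (\<lambda>f x. S (T f) x - Q f x)"
    by (rule ess_norm_le[OF ST Q])
  also have "\<dots> = L2_opnorm \<pi> (\<lambda>f. S' (T' f))"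
    by (rule L2_opnorm_cong_AE[OF L2_bounded_op_diff[OF ST L2_compact_op_bounded[OF Q]]
          L2_bounded_op_comp[OF S' T'] eq])
  also have "\<dots> \<le> L2_opnorm \<pi> S' * L2_opnorm \<pi> T'"
    by (rule L2_opnorm_comp_le[OF S' T'])
  finally show ?thesis unfolding S'_def T'_def .
qed

lemma ess_norm_comp_le:
  assumes S: "L2_bounded_op \<pi> S" and T: "L2_bounded_op \<pi> T"
  shows "ess_norm \<pi> (\<lambda>f. S (T f)) \<le> ess_norm \<pi> S * ess_norm \<pi> T"
proof -
  have "ess_norm \<pi> (\<lambda>f. S (T f)) \<le> (ess_norm \<pi> S + e) * (ess_norm \<pi> T + e)" if "e > 0" for e
  proof -
    obtain K where K: "L2_compact_op \<pi> K" "L2_opnorm \<pi> (\<lambda>f x. S f x - K f x) < ess_norm \<pi> S + e"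
      by (rule ess_norm_approx[OF S \<open>e > 0\<close>])
    obtain L where L: "L2_compact_op \<pi> L" "L2_opnorm \<pi> (\<lambda>f x. T f x - L f x) < ess_norm \<pi> T + e"
      by (rule ess_norm_approx[OF T \<open>e > 0\<close>])
    have "ess_norm \<pi> (\<lambda>f. S (T f))
        \<le> L2_opnorm \<pi> (\<lambda>f x. S f x - K f x) * L2_opnorm \<pi> (\<lambda>f x. T f x - L f x)"
      by (rule ess_norm_comp_le_opnorm_mult[OF S T K(1) L(1)])
    also have "\<dots> \<le> (ess_norm \<pi> S + e) * (ess_norm \<pi> T + e)"
      using K(2) L(2) \<open>e > 0\<close> ess_norm_nonneg[OF S]
      by (intro mult_mono L2_opnorm_nonneg L2_bounded_op_diff T L2_compact_op_bounded L(1)) auto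
    finally show ?thesis .
  qed
  then show ?thesis
    using isCont_le_of_right[of 0 "\<lambda>e. (ess_norm \<pi> S + e) * (ess_norm \<pi> T + e)"] by simp
qed

lemma submultiplicative_mult_add_le:
  fixes a :: "nat \<Rightarrow> real"
  assumes nonneg: "\<And>n. a n \<ge> 0" and submult: "\<And>m n. a (m + n) \<le> a m * a n"
  shows "a (m * k + j) \<le> a m ^ k * a j"
proof (induction k)
  case (Suc k)
  have "a (m * Suc k + j) \<le> a m * a (m * k + j)"
    using submult[of m "m * k + j"] by (simp add: algebra_simps)
  also have "\<dots> \<le> a m * (a m ^ k * a j)"
    by (intro mult_left_mono Suc nonneg)
  finally show ?case by (simp add: mult.assoc)
qed simp

lemma submultiplicative_exponential_bound:
  fixes a :: "nat \<Rightarrow> real"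
  assumes nonneg: "\<And>n. a n \<ge> 0" and submult: "\<And>m n. a (m + n) \<le> a m * a n"
    and "m \<ge> 1" "c > 0" "a m \<le> c ^ m"
  obtains M where "M > 0" "\<And>n. a n \<le> M * c ^ n"
proof -
  define M where "M = (\<Sum>j<m. a j / c ^ j) + 1"
  have remainder: "a j \<le> M * c ^ j" if "j < m" for j
  proof -
    have "a j / c ^ j \<le> (\<Sum>j<m. a j / c ^ j)"
      using that \<open>c > 0\<close> nonneg by (intro member_le_sum) auto
    then have "a j / c ^ j \<le> M" by (simp add: M_def)
    then show ?thesis using \<open>c > 0\<close> by (simp add: field_simps)
  qed
  have "a n \<le> M * c ^ n" for n
  proof -
    have "a n \<le> a m ^ (n div m) * a (n mod m)"
      using submultiplicative_mult_add_le[of a m "n div m" "n mod m"] nonneg submult by simp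
    also have "\<dots> \<le> (c ^ m) ^ (n div m) * (M * c ^ (n mod m))"
      using assms(3-5) by (intro mult_mono power_mono remainder nonneg) auto
    also have "\<dots> = M * c ^ (m * (n div m) + n mod m)"
      unfolding power_add power_mult by simp
    finally show ?thesis by simp
  qed
  moreover have "M > 0"
    unfolding M_def using \<open>c > 0\<close> nonneg by (intro add_nonneg_pos sum_nonneg) auto
  ultimately show thesis using that by blast
qed

lemma eventually_root_less_of_exponential_bound:
  fixes a :: "nat \<Rightarrow> real"
  assumes nonneg: "\<And>n. a n \<ge> 0" and "M > 0" "c > 0" "c < y" and bound: "\<And>n. a n \<le> M * c ^ n"
  shows "\<forall>\<^sub>F n in sequentially. a n powr (1 / real n) < y"
proof -
  have "(\<lambda>n. M powr (1 / real n) * c) \<longlonglongrightarrow> M powr 0 * c"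
    using \<open>M > 0\<close> by (intro tendsto_intros lim_1_over_n) auto
  then have "\<forall>\<^sub>F n in sequentially. M powr (1 / real n) * c < y"
    using \<open>M > 0\<close> \<open>c < y\<close> by (intro order_tendstoD(2)) auto
  then show ?thesis
    using eventually_ge_at_top[of "1::nat"]
  proof eventually_elim
    case (elim n)
    have "a n powr (1 / real n) \<le> (M * c ^ n) powr (1 / real n)"
      by (intro powr_mono2 bound nonneg) auto
    also have "\<dots> = M powr (1 / real n) * c"
      using \<open>M > 0\<close> \<open>c > 0\<close> elim(2) by (simp add: powr_mult powr_realpow[symmetric] powr_powr)
    finally show ?case using elim(1) by simp
  qed
qed

lemma submultiplicative_root_tendsto_INF:
  fixes a :: "nat \<Rightarrow> real"
  assumes nonneg: "\<And>n. a n \<ge> 0" and submult: "\<And>m n. a (m + n) \<le> a m * a n"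
  shows "(\<lambda>n. a n powr (1 / real n)) \<longlonglongrightarrow> (INF n\<in>{1..}. a n powr (1 / real n))"
proof -
  define u where "u = (\<lambda>n. a n powr (1 / real n))"
  define L where "L = (INF n\<in>{1..}. u n)"
  have bdd: "bdd_below (u ` {1..})" by (rule bdd_belowI2[where m = 0]) (simp add: u_def)
  have "u \<longlonglongrightarrow> L"
  proof (rule order_tendstoI)
    fix y assume "y < L"
    moreover have "L \<le> u n" if "n \<ge> 1" for n
      unfolding L_def using that by (intro cINF_lower bdd) auto
    ultimately show "\<forall>\<^sub>F n in sequentially. y < u n"
      by (intro eventually_sequentiallyI[of 1]) (auto intro: less_le_trans)
  next
    fix y assume "L < y"
    then obtain c where c: "L < c" "c < y" using dense by blast
    have "0 \<le> L" unfolding L_def by (rule cINF_greatest) (auto simp: u_def)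
    with c have "c > 0" by simp
    obtain m where m: "m \<ge> 1" "u m < c"
      using c(1) cINF_less_iff[OF _ bdd, of c] by (auto simp: L_def)
    have "a m = u m powr real m"
      using m(1) nonneg[of m] by (simp add: u_def powr_powr)
    also have "\<dots> \<le> c powr real m" using m(2) by (intro powr_mono2) (auto simp: u_def)
    also have "\<dots> = c ^ m" using \<open>c > 0\<close> by (simp add: powr_realpow)
    finally obtain M where "M > 0" "\<And>n. a n \<le> M * c ^ n"
      using submultiplicative_exponential_bound[of a m c] nonneg submult m(1) \<open>c > 0\<close> by blast
    then show "\<forall>\<^sub>F n in sequentially. u n < y"
      unfolding u_def using eventually_root_less_of_exponential_bound nonneg \<open>c > 0\<close> c(2) by blast
  qed
  then show ?thesis unfolding u_def L_def .
qed

lemma ess_spec_radius_le_ess_norm: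
  assumes T: "L2_bounded_op \<pi> T"
  shows "ess_spec_radius \<pi> T \<le> ess_norm \<pi> T"
proof -
  define a where "a n = ess_norm \<pi> (T ^^ n)" for n
  have nonneg: "a n \<ge> 0" for n
    unfolding a_def by (intro ess_norm_nonneg L2_bounded_op_funpow T)
  have submult: "a (m + n) \<le> a m * a n" for m n
    using ess_norm_comp_le[OF L2_bounded_op_funpow[OF T] L2_bounded_op_funpow[OF T], of m n]
    by (simp add: a_def funpow_add comp_def)
  have "ess_spec_radius \<pi> T = (INF n\<in>{1..}. a n powr (1 / real n))"
    using limI[OF submultiplicative_root_tendsto_INF[OF nonneg submult]]
    by (simp add: ess_spec_radius_def a_def ess_norm_def)
  also have "\<dots> \<le> a 1 powr (1 / real 1)"
    by (intro cINF_lower bdd_belowI2[where m = 0]) auto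
  also have "\<dots> = ess_norm \<pi> T" using nonneg[of 1] by (simp add: a_def)
  finally show ?thesis .
qed

section \<open>Integral operators\<close>

lemma nn_integral_weighted_square_le:
  assumes [measurable]: "k \<in> borel_measurable M" "g \<in> borel_measurable M"
  shows "(\<integral>\<^sup>+u. k u * g u \<partial>M)\<^sup>2 \<le> (\<integral>\<^sup>+u. k u \<partial>M) * (\<integral>\<^sup>+u. k u * (g u)\<^sup>2 \<partial>M)"
proof -
  have "(\<integral>\<^sup>+u. 1 * g u \<partial>density M k)\<^sup>2 \<le> (\<integral>\<^sup>+u. 1\<^sup>2 \<partial>density M k) * (\<integral>\<^sup>+u. (g u)\<^sup>2 \<partial>density M k)"
    by (rule Cauchy_Schwarz_nn_integral) measurable
  then show ?thesis by (simp add: nn_integral_density del: nn_integral_const)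
qed

lemma nn_integral_lborel_translate:
  fixes u :: "'a::euclidean_space"
  assumes [measurable]: "h \<in> borel_measurable borel"
  shows "(\<integral>\<^sup>+x. h (u + x) \<partial>lborel) = (\<integral>\<^sup>+x. h x \<partial>lborel)"
  by (subst (2) lborel_distr_plus[of u, symmetric]) (simp add: nn_integral_distr)

lemma nn_integral_convolution_square_le:
  fixes k h :: "'a::euclidean_space \<Rightarrow> ennreal"
  assumes [measurable]: "k \<in> borel_measurable borel" "h \<in> borel_measurable borel"
  shows "(\<integral>\<^sup>+x. (\<integral>\<^sup>+u. k u * h (x + u) \<partial>lborel)\<^sup>2 \<partial>lborel)
    \<le> (\<integral>\<^sup>+u. k u \<partial>lborel)\<^sup>2 * (\<integral>\<^sup>+x. (h x)\<^sup>2 \<partial>lborel)"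
proof -
  let ?K = "\<integral>\<^sup>+u. k u \<partial>lborel" and ?H = "\<integral>\<^sup>+x. (h x)\<^sup>2 \<partial>lborel"
  have "(\<integral>\<^sup>+x. (\<integral>\<^sup>+u. k u * h (x + u) \<partial>lborel)\<^sup>2 \<partial>lborel)
      \<le> (\<integral>\<^sup>+x. ?K * (\<integral>\<^sup>+u. k u * (h (x + u))\<^sup>2 \<partial>lborel) \<partial>lborel)"
    by (intro nn_integral_mono nn_integral_weighted_square_le) measurable
  also have "\<dots> = ?K * (\<integral>\<^sup>+x. (\<integral>\<^sup>+u. k u * (h (x + u))\<^sup>2 \<partial>lborel) \<partial>lborel)"
    by (rule nn_integral_cmult) measurable
  also have "(\<integral>\<^sup>+x. (\<integral>\<^sup>+u. k u * (h (x + u))\<^sup>2 \<partial>lborel) \<partial>lborel)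
      = (\<integral>\<^sup>+u. (\<integral>\<^sup>+x. k u * (h (x + u))\<^sup>2 \<partial>lborel) \<partial>lborel)"
    by (rule lborel_pair.Fubini'[symmetric]) measurable
  also have "\<dots> = (\<integral>\<^sup>+u. k u * ?H \<partial>lborel)"
    by (intro nn_integral_cong)
      (simp add: nn_integral_cmult nn_integral_lborel_translate[of "\<lambda>x. (h x)\<^sup>2"] add.commute)
  also have "\<dots> = ?K * ?H" by (rule nn_integral_multc) measurable
  finally show ?thesis by (simp add: power2_eq_square mult.assoc)
qed

lemma borel_measurable_indicator_mult_continuous:
  fixes f :: "real \<Rightarrow> complex"
  assumes "A \<in> sets borel" "continuous_on A f"
  shows "(\<lambda>x. indicator A x * f x) \<in> borel_measurable borel"
  using borel_measurable_continuous_on_indicator[OF assms]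
  by (simp add: scaleR_conv_of_real of_real_indicator)

definition kernel_integral ::
    "(real \<Rightarrow> real \<Rightarrow> complex) \<Rightarrow> real set \<Rightarrow> (real \<Rightarrow> complex) \<Rightarrow> real \<Rightarrow> complex" where
  "kernel_integral k B f x = (LINT y:B|lborel. f y * k x y)"

locale continuous_density =
  fixes \<pi> :: "real \<Rightarrow> real"
  assumes pi_pos: "\<And>x. \<pi> x > 0"
    and pi_cont: "continuous_on UNIV \<pi>"
    and pi_int: "integrable lborel \<pi>"
    and pi_one: "(\<integral>x. \<pi> x \<partial>lborel) = 1"
begin

lemma pi_nonneg [simp]: "\<pi> x \<ge> 0"
  using pi_pos by (simp add: less_imp_le)

lemma pi_measurable [measurable]: "\<pi> \<in> borel_measurable borel"
  using pi_cont by (rule borel_measurable_continuous_onI)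

lemma nn_integral_pi_measure:
  "g \<in> borel_measurable borel \<Longrightarrow> (\<integral>\<^sup>+x. g x \<partial>pi_measure \<pi>) = (\<integral>\<^sup>+x. ennreal (\<pi> x) * g x \<partial>lborel)"
  unfolding pi_measure_def by (rule nn_integral_density) measurable

lemma emeasure_pi_measure_UNIV: "emeasure (pi_measure \<pi>) UNIV = 1"
  using nn_integral_pi_measure[of "\<lambda>_. 1"] nn_integral_eq_integral[OF pi_int] pi_one
  by simp

lemma L2_of_bounded:
  assumes [measurable]: "f \<in> borel_measurable borel" and bound: "\<And>x. cmod (f x) \<le> c"
  shows "f \<in> L2 \<pi>" and "L2norm \<pi> f \<le> c"
proof -
  have "c \<ge> 0" using bound[of 0] norm_ge_zero order_trans by blast
  have "(\<integral>\<^sup>+x. (ennreal (cmod (f x)))\<^sup>2 \<partial>pi_measure \<pi>) \<le> (\<integral>\<^sup>+x. ennreal (c\<^sup>2) \<partial>pi_measure \<pi>)"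
    by (intro nn_integral_mono) (simp add: ennreal_power bound power_mono)
  also have "\<dots> = ennreal (c\<^sup>2)" by (simp add: emeasure_pi_measure_UNIV)
  finally show "f \<in> L2 \<pi>" "L2norm \<pi> f \<le> c"
    using L2_nn_integralI[OF assms(1) \<open>c \<ge> 0\<close>] by blast+
qed

lemma nn_integral_cmod_sqrt_pi_power2:
  assumes [measurable]: "f \<in> borel_measurable borel"
  shows "(\<integral>\<^sup>+x. (ennreal (cmod (f x) * sqrt (\<pi> x)))\<^sup>2 \<partial>lborel)
    = (\<integral>\<^sup>+x. (ennreal (cmod (f x)))\<^sup>2 \<partial>pi_measure \<pi>)"
  by (subst nn_integral_pi_measure)
    (auto intro!: nn_integral_cong simp: ennreal_mult'' power_mult_distrib ennreal_power
      mult.commute)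

lemma L2_of_convolution_bound:
  assumes f: "f \<in> L2 \<pi>" and [measurable]: "g \<in> borel_measurable borel" "k \<in> borel_measurable borel"
    and "b \<ge> 0" and k: "(\<integral>\<^sup>+u. k u \<partial>lborel) = ennreal b"
    and bound: "\<And>x. ennreal (cmod (g x) * sqrt (\<pi> x))
      \<le> (\<integral>\<^sup>+u. k u * ennreal (cmod (f (x + u)) * sqrt (\<pi> (x + u))) \<partial>lborel)"
  shows "g \<in> L2 \<pi>" and "L2norm \<pi> g \<le> b * L2norm \<pi> f"
proof -
  have [measurable]: "f \<in> borel_measurable borel" by (rule L2_measurable[OF f])
  have "(\<integral>\<^sup>+x. (ennreal (cmod (g x)))\<^sup>2 \<partial>pi_measure \<pi>)
      = (\<integral>\<^sup>+x. (ennreal (cmod (g x) * sqrt (\<pi> x)))\<^sup>2 \<partial>lborel)"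
    by (simp add: nn_integral_cmod_sqrt_pi_power2)
  also have "\<dots> \<le> (\<integral>\<^sup>+x. (\<integral>\<^sup>+u. k u * ennreal (cmod (f (x + u)) * sqrt (\<pi> (x + u))) \<partial>lborel)\<^sup>2 \<partial>lborel)"
    by (intro nn_integral_mono power_mono_ennreal bound)
  also have "\<dots> \<le> (\<integral>\<^sup>+u. k u \<partial>lborel)\<^sup>2 * (\<integral>\<^sup>+x. (ennreal (cmod (f x) * sqrt (\<pi> x)))\<^sup>2 \<partial>lborel)"
    by (rule nn_integral_convolution_square_le) measurable
  also have "\<dots> = ennreal ((b * L2norm \<pi> f)\<^sup>2)"
    unfolding k nn_integral_cmod_sqrt_pi_power2[OF L2_measurable[OF f]] nn_integral_cmod_power2[OF f]
    using \<open>b \<ge> 0\<close> by (simp add: ennreal_power power_mult_distrib ennreal_mult)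
  finally show "g \<in> L2 \<pi>" "L2norm \<pi> g \<le> b * L2norm \<pi> f"
    using L2_nn_integralI[OF assms(2), of "b * L2norm \<pi> f" \<pi>] \<open>b \<ge> 0\<close> by simp_all
qed

lemma L2_indicator_divide_pi:
  assumes "compact B"
  shows "(\<lambda>y. complex_of_real (indicator B y / \<pi> y)) \<in> L2 \<pi>"
proof -
  have [measurable]: "B \<in> sets borel" using assms by (rule borel_compact)
  have "bounded ((\<lambda>y. 1 / \<pi> y) ` B)"
    using pi_pos assms
    by (intro compact_imp_bounded compact_continuous_image continuous_intros
        continuous_on_subset[OF pi_cont]) (auto simp: less_imp_neq[symmetric])
  then obtain C where "\<And>y. y \<in> B \<Longrightarrow> norm (1 / \<pi> y) \<le> C"
    by (auto simp: bounded_iff)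
  then have "cmod (complex_of_real (indicator B y / \<pi> y)) \<le> max C 0" for y
    by (cases "y \<in> B") (auto simp: le_max_iff_disj simp flip: of_real_divide)
  then show ?thesis by (intro L2_of_bounded(1)) measurable
qed

lemma L2_set_integral_compact:
  assumes "compact B"
  obtains C where "C \<ge> 0" "\<And>f. f \<in> L2 \<pi> \<Longrightarrow> set_integrable lborel B (\<lambda>y. cmod (f y))"
    and "\<And>f. f \<in> L2 \<pi> \<Longrightarrow> (LINT y:B|lborel. cmod (f y)) \<le> L2norm \<pi> f * C"
proof -
  define h where "h y = complex_of_real (indicator B y / \<pi> y)" for y
  have h: "h \<in> L2 \<pi>" unfolding h_def by (rule L2_indicator_divide_pi[OF assms])
  have density: "\<pi> y *\<^sub>R (cmod (f y) * cmod (h y)) = indicator B y *\<^sub>R cmod (f y)" for f y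
    using pi_pos[of y] by (simp add: h_def norm_divide indicator_def)
  have meas: "(\<lambda>y. cmod (f y) * cmod (h y)) \<in> borel_measurable lborel" if "f \<in> L2 \<pi>" for f
    using L2_measurable[OF that] L2_measurable[OF h] by measurable
  show thesis
  proof (rule that[of "L2norm \<pi> h"])
    fix f assume f: "f \<in> L2 \<pi>"
    show "set_integrable lborel B (\<lambda>y. cmod (f y))"
      using L2_Cauchy_Schwarz(1)[OF f h]
      by (simp add: pi_measure_def integrable_density[OF meas[OF f]] density set_integrable_def
          del: real_scaleR_def)
    have "(LINT y:B|lborel. cmod (f y)) = (\<integral>y. cmod (f y) * cmod (h y) \<partial>pi_measure \<pi>)"
      by (simp add: pi_measure_def integral_density[OF meas[OF f]] density set_lebesgue_integral_def
          del: real_scaleR_def)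
    then show "(LINT y:B|lborel. cmod (f y)) \<le> L2norm \<pi> f * L2norm \<pi> h"
      using L2_Cauchy_Schwarz(2)[OF f h] by simp
  qed simp
qed

lemma set_integrable_cmod_compact:
  assumes "f \<in> L2 \<pi>" "compact B"
  shows "set_integrable lborel B (\<lambda>y. cmod (f y))"
  using L2_set_integral_compact[OF assms(2)] assms(1) by metis

lemma set_integrable_mult_continuous:
  assumes f: "f \<in> L2 \<pi>" and "compact B" and \<phi>: "continuous_on B \<phi>"
  shows "set_integrable lborel B (\<lambda>y. f y * \<phi> y)"
proof -
  have [measurable]: "f \<in> borel_measurable borel" "B \<in> sets borel"
    using L2_measurable[OF f] borel_compact[OF \<open>compact B\<close>] .
  obtain C where C: "\<And>y. y \<in> B \<Longrightarrow> cmod (\<phi> y) \<le> C"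
    using compact_imp_bounded[OF compact_continuous_image[OF \<phi> \<open>compact B\<close>]]
    by (auto simp: bounded_iff)
  have [measurable]: "(\<lambda>y. indicator B y *\<^sub>R \<phi> y) \<in> borel_measurable borel"
    by (rule borel_measurable_continuous_on_indicator[OF _ \<phi>]) measurable
  have "(\<lambda>y. f y * (indicator B y *\<^sub>R \<phi> y)) \<in> borel_measurable lborel" by measurable
  then have meas: "set_borel_measurable lborel B (\<lambda>y. f y * \<phi> y)"
    by (simp add: set_borel_measurable_def)
  have "set_integrable lborel B (\<lambda>y. C * cmod (f y))"
    by (intro set_integrable_mult_right set_integrable_cmod_compact f \<open>compact B\<close>)
  moreover have "norm (f y * \<phi> y) \<le> norm (C * cmod (f y))" if "y \<in> B" for y
    using mult_right_mono[OF order_trans[OF C[OF that] abs_ge_self] norm_ge_zero[of "f y"]]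
    by (simp add: norm_mult abs_mult mult.commute)
  ultimately show ?thesis
    by (intro set_integrable_bound[OF _ meas]) auto
qed

lemma cmod_set_integral_mult_le:
  assumes f: "f \<in> L2 \<pi>" and "compact B" and "continuous_on B \<phi>"
    and bound: "\<And>y. y \<in> B \<Longrightarrow> cmod (\<phi> y) \<le> e"
  shows "cmod (LINT y:B|lborel. f y * \<phi> y) \<le> e * (LINT y:B|lborel. cmod (f y))"
proof -
  note int = set_integrable_mult_continuous[OF assms(1-3)]
  have "cmod (LINT y:B|lborel. f y * \<phi> y) \<le> (LINT y:B|lborel. cmod (f y * \<phi> y))"
    by (rule set_integral_norm_bound[OF int])
  also have "\<dots> \<le> (LINT y:B|lborel. e * cmod (f y))"
  proof (intro set_integral_mono set_integrable_norm[OF int] set_integrable_mult_right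
      set_integrable_cmod_compact f \<open>compact B\<close>)
    show "cmod (f y * \<phi> y) \<le> e * cmod (f y)" if "y \<in> B" for y
      using mult_right_mono[OF bound[OF that] norm_ge_zero[of "f y"]]
      by (simp add: norm_mult mult.commute)
  qed
  finally show ?thesis by simp
qed

lemma L2_Cauchy_subseq_of_equicontinuous:
  fixes gs :: "nat \<Rightarrow> real \<Rightarrow> complex"
  assumes "compact A" and cont: "\<And>n. continuous_on A (gs n)"
    and bounded: "\<And>n x. x \<in> A \<Longrightarrow> cmod (gs n x) \<le> C"
    and equicont: "\<And>x e. x \<in> A \<Longrightarrow> 0 < e \<Longrightarrow>
      \<exists>d>0. \<forall>n y. y \<in> A \<and> norm (x - y) < d \<longrightarrow> cmod (gs n x - gs n y) < e"
  shows "\<exists>\<phi>. strict_mono \<phi> \<and> L2_Cauchy \<pi> (\<lambda>n x. indicator A x * gs (\<phi> n) x)"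
proof -
  obtain g and \<phi> :: "nat \<Rightarrow> nat" where \<phi>: "strict_mono \<phi>" and
    uniform: "\<And>e. 0 < e \<Longrightarrow> \<exists>N. \<forall>n x. n \<ge> N \<and> x \<in> A \<longrightarrow> norm (gs (\<phi> n) x - g x) < e"
    by (rule Arzela_Ascoli[OF \<open>compact A\<close> bounded equicont]) auto
  have meas: "(\<lambda>x. indicator A x * gs n x) \<in> borel_measurable borel" for n
    by (intro borel_measurable_indicator_mult_continuous borel_compact \<open>compact A\<close> cont)
  have "L2_Cauchy \<pi> (\<lambda>n x. indicator A x * gs (\<phi> n) x)"
  proof (rule L2_CauchyI)
    fix e :: real assume "e > 0"
    then obtain N where N: "\<And>n x. n \<ge> N \<Longrightarrow> x \<in> A \<Longrightarrow> cmod (gs (\<phi> n) x - g x) < e / 4"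
      using uniform[of "e / 4"] by auto
    have "L2norm \<pi> (\<lambda>x. indicator A x * gs (\<phi> m) x - indicator A x * gs (\<phi> n) x) \<le> e / 2"
      if "m \<ge> N" "n \<ge> N" for m n
    proof (rule L2_of_bounded(2))
      show "cmod (indicator A x * gs (\<phi> m) x - indicator A x * gs (\<phi> n) x) \<le> e / 2" for x
        using norm_triangle_ineq4[of "gs (\<phi> m) x - g x" "gs (\<phi> n) x - g x"]
          N[OF that(1), of x] N[OF that(2), of x] \<open>e > 0\<close>
        by (cases "x \<in> A") auto
    qed (intro borel_measurable_diff meas)
    with \<open>e > 0\<close> show "\<exists>N. \<forall>m\<ge>N. \<forall>n\<ge>N.
        L2norm \<pi> (\<lambda>x. indicator A x * gs (\<phi> m) x - indicator A x * gs (\<phi> n) x) < e"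
      by (intro exI[of _ N]) fastforce
  qed
  with \<phi> show ?thesis by blast
qed

context
  fixes A B :: "real set" and k :: "real \<Rightarrow> real \<Rightarrow> complex"
  assumes compact: "compact A" "compact B"
    and kernel_cont: "continuous_on (A \<times> B) (\<lambda>(x, y). k x y)"
begin

lemma kernel_section_continuous:
  assumes "x \<in> A"
  shows "continuous_on B (k x)"
proof -
  have "continuous_on B (\<lambda>y. (x, y))"
    by (intro continuous_on_Pair continuous_on_const continuous_on_id)
  then show ?thesis
    using continuous_on_compose2[OF kernel_cont, of B "Pair x"] assms by auto
qed

lemma kernel_integral_lincomb:
  assumes "f \<in> L2 \<pi>" "g \<in> L2 \<pi>" "x \<in> A"
  shows "kernel_integral k B (\<lambda>y. c * f y + g y) x = c * kernel_integral k B f x + kernel_integral k B g x"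
  using set_integrable_mult_continuous[OF assms(1) compact(2) kernel_section_continuous[OF assms(3)]]
    set_integrable_mult_continuous[OF assms(2) compact(2) kernel_section_continuous[OF assms(3)]]
  by (simp add: kernel_integral_def distrib_right mult.assoc)

lemma kernel_integral_diff_le:
  assumes f: "f \<in> L2 \<pi>" and x: "x \<in> A" "x' \<in> A"
    and "\<And>y. y \<in> B \<Longrightarrow> cmod (k x y - k x' y) \<le> e"
  shows "cmod (kernel_integral k B f x - kernel_integral k B f x') \<le> e * (LINT y:B|lborel. cmod (f y))"
proof -
  note cont = kernel_section_continuous[OF x(1)] kernel_section_continuous[OF x(2)]
  have "kernel_integral k B f x - kernel_integral k B f x' = (LINT y:B|lborel. f y * (k x y - k x' y))"
    using set_integrable_mult_continuous[OF f compact(2) cont(1)]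
      set_integrable_mult_continuous[OF f compact(2) cont(2)]
    by (simp add: kernel_integral_def right_diff_distrib)
  also have "cmod \<dots> \<le> e * (LINT y:B|lborel. cmod (f y))"
    by (intro cmod_set_integral_mult_le f compact continuous_intros cont assms(4))
  finally show ?thesis .
qed

lemma kernel_integral_equicontinuous:
  assumes "e > 0"
  obtains d where "d > 0" "\<And>f x x'. f \<in> L2 \<pi> \<Longrightarrow> x \<in> A \<Longrightarrow> x' \<in> A \<Longrightarrow> dist x x' < d \<Longrightarrow>
    cmod (kernel_integral k B f x - kernel_integral k B f x') \<le> e * L2norm \<pi> f"
proof -
  obtain C where C: "C \<ge> 0" "\<And>f. f \<in> L2 \<pi> \<Longrightarrow> (LINT y:B|lborel. cmod (f y)) \<le> L2norm \<pi> f * C"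
    using L2_set_integral_compact[OF compact(2)] by metis
  define e' where "e' = e / (C + 1)"
  have "e' > 0" and "e' * C \<le> e"
    using \<open>e > 0\<close> C(1) by (auto simp: e'_def field_simps)
  have "uniformly_continuous_on (A \<times> B) (\<lambda>(x, y). k x y)"
    by (intro compact_uniformly_continuous kernel_cont compact_Times compact)
  then obtain d where d: "d > 0"
    "\<And>z z'. z \<in> A \<times> B \<Longrightarrow> z' \<in> A \<times> B \<Longrightarrow> dist z' z < d \<Longrightarrow>
      dist (case z' of (x, y) \<Rightarrow> k x y) (case z of (x, y) \<Rightarrow> k x y) < e'"
    using uniformly_continuous_onE[OF _ \<open>e' > 0\<close>] by metis
  have "cmod (kernel_integral k B f x - kernel_integral k B f x') \<le> e * L2norm \<pi> f"
    if f: "f \<in> L2 \<pi>" and x: "x \<in> A" "x' \<in> A" "dist x x' < d" for f x x'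
  proof -
    have "cmod (k x y - k x' y) \<le> e'" if "y \<in> B" for y
      using d(2)[of "(x', y)" "(x, y)"] x that by (simp add: dist_Pair_Pair dist_norm less_imp_le)
    then have "cmod (kernel_integral k B f x - kernel_integral k B f x')
        \<le> e' * (LINT y:B|lborel. cmod (f y))"
      by (intro kernel_integral_diff_le f x)
    also have "\<dots> \<le> e' * (L2norm \<pi> f * C)"
      using \<open>e' > 0\<close> C(2)[OF f] by simp
    also have "\<dots> \<le> e * L2norm \<pi> f"
      using mult_right_mono[OF \<open>e' * C \<le> e\<close> L2norm_nonneg[of \<pi> f]] by (simp add: ac_simps)
    finally show ?thesis .
  qed
  with d(1) show thesis by (rule that)
qed

lemma kernel_integral_continuous:
  assumes "f \<in> L2 \<pi>"
  shows "continuous_on A (kernel_integral k B f)"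
  unfolding continuous_on_iff
proof (intro ballI allI impI)
  fix x and e :: real assume "x \<in> A" "e > 0"
  define e' where "e' = e / (L2norm \<pi> f + 1)"
  have pos: "L2norm \<pi> f + 1 > 0" by (simp add: add_nonneg_pos)
  have "e' > 0" and less: "e' * L2norm \<pi> f < e"
    using \<open>e > 0\<close> pos by (auto simp: e'_def field_simps)
  obtain d where "d > 0" "\<And>f x x'. f \<in> L2 \<pi> \<Longrightarrow> x \<in> A \<Longrightarrow> x' \<in> A \<Longrightarrow> dist x x' < d \<Longrightarrow>
      cmod (kernel_integral k B f x - kernel_integral k B f x') \<le> e' * L2norm \<pi> f"
    by (rule kernel_integral_equicontinuous[OF \<open>e' > 0\<close>]) blast
  with assms \<open>x \<in> A\<close> less show "\<exists>d>0. \<forall>x'\<in>A. dist x' x < d \<longrightarrow>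
      dist (kernel_integral k B f x') (kernel_integral k B f x) < e"
    unfolding dist_norm by (meson le_less_trans)
qed

lemma kernel_integral_bounded:
  obtains M where "M \<ge> 0" "\<And>f x. f \<in> L2 \<pi> \<Longrightarrow> x \<in> A \<Longrightarrow> cmod (kernel_integral k B f x) \<le> M * L2norm \<pi> f"
proof -
  obtain C where C: "C \<ge> 0" "\<And>f. f \<in> L2 \<pi> \<Longrightarrow> (LINT y:B|lborel. cmod (f y)) \<le> L2norm \<pi> f * C"
    using L2_set_integral_compact[OF compact(2)] by metis
  obtain D where D: "D > 0" "\<And>x y. x \<in> A \<Longrightarrow> y \<in> B \<Longrightarrow> cmod (k x y) \<le> D"
    using compact_imp_bounded[OF compact_continuous_image[OF kernel_cont compact_Times[OF compact]]]
    unfolding bounded_pos by fastforce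
  have "cmod (kernel_integral k B f x) \<le> D * C * L2norm \<pi> f" if "f \<in> L2 \<pi>" "x \<in> A" for f x
  proof -
    have "cmod (kernel_integral k B f x) \<le> D * (LINT y:B|lborel. cmod (f y))"
      unfolding kernel_integral_def using that
      by (intro cmod_set_integral_mult_le compact kernel_section_continuous D)
    also have "\<dots> \<le> D * (L2norm \<pi> f * C)" using C(2)[OF that(1)] D(1) by simp
    finally show ?thesis by (simp add: ac_simps)
  qed
  with C(1) D(1) show thesis by (intro that[of "D * C"]) auto
qed

lemma L2_linear_op_kernel_integral:
  "L2_linear_op \<pi> (\<lambda>f x. indicator A x * kernel_integral k B f x)"
proof (rule L2_linear_opI)
  obtain M where M: "M \<ge> 0"
    "\<And>f x. f \<in> L2 \<pi> \<Longrightarrow> x \<in> A \<Longrightarrow> cmod (kernel_integral k B f x) \<le> M * L2norm \<pi> f"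
    by (rule kernel_integral_bounded) blast
  fix f assume f: "f \<in> L2 \<pi>"
  show "(\<lambda>x. indicator A x * kernel_integral k B f x) \<in> L2 \<pi>"
  proof (rule L2_of_bounded(1))
    show "(\<lambda>x. indicator A x * kernel_integral k B f x) \<in> borel_measurable borel"
      by (intro borel_measurable_indicator_mult_continuous borel_compact compact
          kernel_integral_continuous f)
    show "cmod (indicator A x * kernel_integral k B f x) \<le> M * L2norm \<pi> f" for x
      using M(1) M(2)[OF f, of x] by (cases "x \<in> A") auto
  qed
  fix g c assume g: "g \<in> L2 \<pi>"
  have "indicator A x * kernel_integral k B (\<lambda>y. c * f y + g y) x
      = c * (indicator A x * kernel_integral k B f x) + indicator A x * kernel_integral k B g x" for x
    using kernel_integral_lincomb[OF f g, of x c] by (cases "x \<in> A") auto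
  then show "AE x in pi_measure \<pi>. indicator A x * kernel_integral k B (\<lambda>y. c * f y + g y) x
      = c * (indicator A x * kernel_integral k B f x) + indicator A x * kernel_integral k B g x"
    by simp
qed

lemma L2_compact_op_kernel_integral:
  "L2_compact_op \<pi> (\<lambda>f x. indicator A x * kernel_integral k B f x)"
proof (rule L2_compact_opI[OF L2_linear_op_kernel_integral])
  obtain M where M: "M \<ge> 0"
    "\<And>f x. f \<in> L2 \<pi> \<Longrightarrow> x \<in> A \<Longrightarrow> cmod (kernel_integral k B f x) \<le> M * L2norm \<pi> f"
    by (rule kernel_integral_bounded) blast
  fix fs :: "nat \<Rightarrow> real \<Rightarrow> complex"
  assume fs: "\<And>n. fs n \<in> L2 \<pi>" "\<And>n. L2norm \<pi> (fs n) \<le> 1"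
  show "\<exists>\<phi>. strict_mono \<phi> \<and> L2_Cauchy \<pi> (\<lambda>n x. indicator A x * kernel_integral k B (fs (\<phi> n)) x)"
  proof (rule L2_Cauchy_subseq_of_equicontinuous[OF compact(1)])
    show "cmod (kernel_integral k B (fs n) x) \<le> M" if "x \<in> A" for n x
      using M(2)[OF fs(1) that, of n] mult_left_mono[OF fs(2)[of n] M(1)] by simp
    fix x and e :: real assume x: "x \<in> A" and "0 < e"
    then have "e / 2 > 0" by simp
    obtain d where d: "d > 0" "\<And>f x x'. f \<in> L2 \<pi> \<Longrightarrow> x \<in> A \<Longrightarrow> x' \<in> A \<Longrightarrow> dist x x' < d \<Longrightarrow>
        cmod (kernel_integral k B f x - kernel_integral k B f x') \<le> e / 2 * L2norm \<pi> f"
      by (rule kernel_integral_equicontinuous[OF \<open>e / 2 > 0\<close>]) blast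
    have "cmod (kernel_integral k B (fs n) x - kernel_integral k B (fs n) y) < e"
      if "y \<in> A" "norm (x - y) < d" for n y
    proof -
      have "cmod (kernel_integral k B (fs n) x - kernel_integral k B (fs n) y) \<le> e / 2 * L2norm \<pi> (fs n)"
        using that by (intro d(2) fs x) (simp_all add: dist_norm)
      also have "\<dots> \<le> e / 2 * 1" using fs(2) \<open>0 < e\<close> by (intro mult_left_mono) auto
      also have "\<dots> < e" using \<open>0 < e\<close> by simp
      finally show ?thesis .
    qed
    with d(1) show "\<exists>d>0. \<forall>n y. y \<in> A \<and> norm (x - y) < d \<longrightarrow>
        cmod (kernel_integral k B (fs n) x - kernel_integral k B (fs n) y) < e"
      by blast
  qed (rule kernel_integral_continuous[OF fs(1)])
qed

end

end

section \<open>The Metropolis--Hastings operator\<close>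

locale metropolis_hastings = continuous_density \<pi> for \<pi> :: "real \<Rightarrow> real" +
  fixes q :: "real \<Rightarrow> real \<Rightarrow> real" and s :: real
  assumes q_nonneg: "\<And>x y. q x y \<ge> 0"
    and q_bdd: "\<exists>B. \<forall>x y. q x y \<le> B"
    and q_cont: "continuous_on UNIV (\<lambda>(x, y). q x y)"
    and q_int: "\<And>x. integrable lborel (q x)"
    and q_one: "\<And>x. (\<integral>y. q x y \<partial>lborel) = 1"
    and q_supp: "\<And>x u. \<bar>u\<bar> > s \<Longrightarrow> q x (x + u) = 0"
begin

abbreviation t where "t \<equiv> mh_t \<pi> q"
abbreviation r where "r \<equiv> mh_r \<pi> q"

lemma t_nonneg [simp]: "t x y \<ge> 0"
  using q_nonneg by (simp add: mh_t_def)

lemma t_le_q: "t x y \<le> q x y"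
  by (simp add: mh_t_def)

lemma t_eq_0: "\<bar>x - y\<bar> > s \<Longrightarrow> t x y = 0"
  using q_supp[of "y - x" x] t_le_q[of x y] t_nonneg[of x y] by (simp add: abs_minus_commute)

lemma t_continuous: "continuous_on UNIV (\<lambda>z. t (fst z) (snd z))"
proof -
  have q_cont': "continuous_on UNIV (\<lambda>z. q (f z) (g z))"
    if "continuous_on UNIV f" "continuous_on UNIV g" for f g :: "real \<times> real \<Rightarrow> real"
    using continuous_on_compose2[OF q_cont continuous_on_Pair[OF that]] by simp
  have pi_cont': "continuous_on UNIV (\<lambda>z. \<pi> (f z))"
    if "continuous_on UNIV f" for f :: "real \<times> real \<Rightarrow> real"
    using continuous_on_compose2[OF pi_cont that] by simp
  show ?thesis
    unfolding mh_t_def using pi_pos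
    by (intro continuous_intros q_cont' pi_cont') (auto simp: less_imp_neq[symmetric])
qed

lemma continuous_on_t [continuous_intros]:
  "continuous_on S f \<Longrightarrow> continuous_on S g \<Longrightarrow> continuous_on S (\<lambda>x. t (f x) (g x))"
  using continuous_on_compose2[OF t_continuous, of S "\<lambda>x. (f x, g x)"]
  by (auto intro: continuous_on_Pair)

lemma t_measurable [measurable (raw)]:
  assumes [measurable]: "f \<in> borel_measurable M" "g \<in> borel_measurable M"
  shows "(\<lambda>x. t (f x) (g x)) \<in> borel_measurable M"
proof -
  have [measurable]: "(\<lambda>z. t (fst z) (snd z)) \<in> borel_measurable borel"
    by (rule borel_measurable_continuous_onI[OF t_continuous])
  have "(\<lambda>x. (\<lambda>z. t (fst z) (snd z)) (f x, g x)) \<in> borel_measurable M"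
    by measurable
  then show ?thesis by simp
qed

lemma t_boundedE:
  obtains B where "\<And>x y. t x y \<le> B"
  using q_bdd t_le_q order_trans by metis

lemma t_integrable: "integrable lborel (t x)"
  by (rule Bochner_Integration.integrable_bound[OF q_int[of x]]) (auto simp: t_le_q q_nonneg)

lemma r_nonneg: "r x \<ge> 0"
  using integral_mono[OF t_integrable q_int, of x x] t_le_q q_one[of x] by (simp add: mh_r_def)

lemma r_le_1: "r x \<le> 1"
  by (simp add: mh_r_def)

lemma r_measurable [measurable]: "r \<in> borel_measurable borel"
proof -
  have "(\<lambda>x. 1 - (\<integral>y. t x y \<partial>lborel)) \<in> borel_measurable borel"
    by measurable
  then show ?thesis by (simp add: mh_r_def[abs_def])
qed

lemma detailed_balance: "\<pi> x * t x y = \<pi> y * t y x"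
proof -
  have "\<pi> x * t x y = min (\<pi> x * q x y) (\<pi> y * q y x)" for x y
    using pi_pos[of x] by (simp add: mh_t_def min_mult_distrib_left)
  then show ?thesis by (simp add: min.commute)
qed

definition sym_t :: "real \<Rightarrow> real \<Rightarrow> real" where
  "sym_t x y = sqrt (t x y * t y x)"

lemma sym_t_nonneg: "sym_t x y \<ge> 0"
  by (simp add: sym_t_def)

lemma sym_t_eq_0: "\<bar>x - y\<bar> > s \<Longrightarrow> sym_t x y = 0"
  by (simp add: sym_t_def t_eq_0)

lemma sym_t_le:
  assumes "\<And>x y. t x y \<le> B"
  shows "sym_t x y \<le> B"
proof -
  have "B \<ge> 0" using order_trans[OF t_nonneg assms] .
  then have "t x y * t y x \<le> B\<^sup>2"
    unfolding power2_eq_square by (intro mult_mono assms) auto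
  then show ?thesis unfolding sym_t_def using \<open>B \<ge> 0\<close> by (intro real_le_lsqrt) auto
qed

lemma t_mult_sqrt_pi: "t x y * sqrt (\<pi> x) = sym_t x y * sqrt (\<pi> y)"
proof -
  have "sym_t x y * sqrt (\<pi> y) = sqrt (t x y * (\<pi> y * t y x))"
    by (simp add: sym_t_def real_sqrt_mult)
  also have "\<dots> = sqrt ((t x y)\<^sup>2 * \<pi> x)"
    by (simp add: detailed_balance[of x y, symmetric] power2_eq_square)
  also have "\<dots> = t x y * sqrt (\<pi> x)" by (simp add: real_sqrt_mult)
  finally show ?thesis by simp
qed

definition sup_kernel :: "real set \<Rightarrow> real \<Rightarrow> real" where
  "sup_kernel X u = (SUP x\<in>X. sym_t x (x + u))"

definition beta :: "real set \<Rightarrow> real" where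
  "beta X = (LINT u:{-s..s}|lborel. sup_kernel X u)"

lemma bdd_above_sym_t: "bdd_above ((\<lambda>x. sym_t x (x + u)) ` X)"
proof -
  obtain B where "\<And>x y. t x y \<le> B" by (rule t_boundedE) blast
  then show ?thesis by (intro bdd_aboveI2[where M = B] sym_t_le)
qed

lemma sym_t_le_sup_kernel: "x \<in> X \<Longrightarrow> sym_t x (x + u) \<le> sup_kernel X u"
  unfolding sup_kernel_def by (intro cSUP_upper bdd_above_sym_t)

context
  fixes X :: "real set"
  assumes nonempty: "X \<noteq> {}"
begin

lemma sup_kernel_nonneg: "sup_kernel X u \<ge> 0"
  using nonempty order_trans[OF sym_t_nonneg sym_t_le_sup_kernel] by blast

lemma sup_kernel_eq_0: "\<bar>u\<bar> > s \<Longrightarrow> sup_kernel X u = 0"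
  unfolding sup_kernel_def using nonempty by (simp add: sym_t_eq_0)

text \<open>A supremum of continuous functions is lower semicontinuous.\<close>

lemma sup_kernel_measurable: "sup_kernel X \<in> borel_measurable borel"
proof (rule borel_measurableI_greater)
  fix y
  have "{u. y < sup_kernel X u} = (\<Union>x\<in>X. {u. y < sym_t x (x + u)})"
    unfolding sup_kernel_def by (auto simp: less_cSUP_iff[OF nonempty bdd_above_sym_t])
  moreover have "open {u. y < sym_t x (x + u)}" for x
    unfolding sym_t_def by (intro open_Collect_less continuous_intros)
  ultimately have "open {u. y < sup_kernel X u}" by (simp add: open_UN)
  then show "{u \<in> space borel. y < sup_kernel X u} \<in> sets borel" by simp
qed

lemma sup_kernel_set_integrable: "set_integrable lborel {-s..s} (sup_kernel X)"
proof -
  obtain B where B: "\<And>x y. t x y \<le> B" by (rule t_boundedE) blast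
  have "sup_kernel X u \<le> B" for u
    unfolding sup_kernel_def by (intro cSUP_least nonempty sym_t_le B)
  then have bound: "norm (sup_kernel X u) \<le> norm B" for u
    using sup_kernel_nonneg[of u] order_trans[OF _ abs_ge_self[of B]] by simp
  have "set_integrable lborel {-s..s} (\<lambda>_. B)"
    by (intro borel_integrable_atLeastAtMost' continuous_on_const)
  then show ?thesis
    by (rule set_integrable_bound)
      (use sup_kernel_measurable bound in \<open>simp_all add: set_borel_measurable_def\<close>)
qed

lemma beta_nonneg: "beta X \<ge> 0"
  unfolding beta_def set_lebesgue_integral_def
  by (intro integral_nonneg_AE) (simp add: sup_kernel_nonneg)

lemma nn_integral_sup_kernel: "(\<integral>\<^sup>+u. ennreal (sup_kernel X u) \<partial>lborel) = ennreal (beta X)"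
proof -
  have restrict: "(\<lambda>u. indicator {-s..s} u *\<^sub>R sup_kernel X u) = sup_kernel X"
  proof
    show "indicator {-s..s} u *\<^sub>R sup_kernel X u = sup_kernel X u" for u
      using sup_kernel_eq_0[of u] by (cases "\<bar>u\<bar> > s") (auto simp: indicator_def)
  qed
  show ?thesis
    unfolding beta_def set_lebesgue_integral_def restrict
    using sup_kernel_set_integrable[unfolded set_integrable_def restrict]
    by (rule nn_integral_eq_integral) (simp add: sup_kernel_nonneg)
qed

end

abbreviation complex_t where "complex_t x y \<equiv> complex_of_real (t x y)"

definition integral_part :: "(real \<Rightarrow> complex) \<Rightarrow> real \<Rightarrow> complex" where
  "integral_part f x = (\<integral>y. f y * complex_t x y \<partial>lborel)"

lemma mh_op_eq: "mh_op \<pi> q f x = complex_of_real (r x) * f x + integral_part f x"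
  by (simp add: mh_op_def integral_part_def)

lemma integral_part_measurable [measurable]:
  assumes [measurable]: "f \<in> borel_measurable borel"
  shows "integral_part f \<in> borel_measurable borel"
proof -
  have "(\<lambda>x. \<integral>y. f y * complex_t x y \<partial>lborel) \<in> borel_measurable borel"
    by measurable
  then show ?thesis by (simp add: integral_part_def[abs_def])
qed

lemma integral_part_indicator_mult:
  "integral_part (\<lambda>y. indicator B y * f y) x = kernel_integral complex_t B f x"
  unfolding integral_part_def kernel_integral_def set_lebesgue_integral_def
  by (intro Bochner_Integration.integral_cong) (auto simp: indicator_def)

lemma integral_part_eq_kernel_integral:
  assumes "\<And>y. y \<notin> B \<Longrightarrow> t x y = 0"
  shows "integral_part f x = kernel_integral complex_t B f x"
  unfolding integral_part_indicator_mult[symmetric] unfolding integral_part_def using assms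
  by (intro Bochner_Integration.integral_cong) (auto simp: indicator_def)

lemma integrable_mult_t:
  assumes "f \<in> L2 \<pi>"
  shows "integrable lborel (\<lambda>y. f y * complex_t x y)"
proof -
  have "set_integrable lborel {x - s..x + s} (\<lambda>y. f y * complex_t x y)"
    by (intro set_integrable_mult_continuous assms continuous_intros) auto
  moreover have "indicator {x - s..x + s} y *\<^sub>R (f y * complex_t x y) = f y * complex_t x y" for y
    using t_eq_0[of x y] by (cases "\<bar>x - y\<bar> > s") (auto simp: indicator_def)
  ultimately show ?thesis by (simp add: set_integrable_def)
qed

lemma integral_part_lincomb:
  assumes "f \<in> L2 \<pi>" "g \<in> L2 \<pi>"
  shows "integral_part (\<lambda>y. c * f y + g y) x = c * integral_part f x + integral_part g x"
proof -
  have "integral_part (\<lambda>y. c * f y + g y) x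
      = (\<integral>y. c * (f y * complex_t x y) + g y * complex_t x y \<partial>lborel)"
    unfolding integral_part_def by (simp add: algebra_simps)
  also have "\<dots> = c * integral_part f x + integral_part g x"
    unfolding integral_part_def using assms[THEN integrable_mult_t, of x] by simp
  finally show ?thesis .
qed

text \<open>Conjugating with \<open>sqrt \<pi>\<close> turns \<open>integral_part\<close> into an operator on \<open>L\<^sup>2(dx)\<close> with kernel
  \<open>sym_t\<close>, which for \<open>x \<in> X\<close> is dominated by a convolution.\<close>

lemma cmod_integral_part_mult_sqrt_pi_le:
  assumes f: "f \<in> L2 \<pi>" and x: "x \<in> X"
  shows "ennreal (cmod (integral_part f x) * sqrt (\<pi> x))
    \<le> (\<integral>\<^sup>+u. ennreal (sup_kernel X u) * ennreal (cmod (f (x + u)) * sqrt (\<pi> (x + u))) \<partial>lborel)"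
proof -
  have [measurable]: "f \<in> borel_measurable borel" by (rule L2_measurable[OF f])
  have "ennreal (cmod (integral_part f x) * sqrt (\<pi> x))
      = ennreal (cmod (integral_part f x)) * ennreal (sqrt (\<pi> x))"
    by (simp add: ennreal_mult')
  also have "\<dots> \<le> (\<integral>\<^sup>+y. ennreal (cmod (f y * complex_t x y)) \<partial>lborel) * ennreal (sqrt (\<pi> x))"
    unfolding integral_part_def by (intro mult_right_mono integral_norm_bound_ennreal integrable_mult_t f) simp
  also have "\<dots> = (\<integral>\<^sup>+y. ennreal (cmod (f y) * (t x y * sqrt (\<pi> x))) \<partial>lborel)"
    by (subst nn_integral_multc[symmetric])
      (simp_all add: norm_mult mult.assoc flip: ennreal_mult'')
  also have "\<dots> = (\<integral>\<^sup>+u. ennreal (cmod (f (x + u)) * (t x (x + u) * sqrt (\<pi> x))) \<partial>lborel)"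
    by (rule nn_integral_lborel_translate[symmetric]) measurable
  also have "\<dots> \<le> (\<integral>\<^sup>+u. ennreal (sup_kernel X u) * ennreal (cmod (f (x + u)) * sqrt (\<pi> (x + u))) \<partial>lborel)"
  proof (rule nn_integral_mono)
    fix u
    have "cmod (f (x + u)) * (t x (x + u) * sqrt (\<pi> x))
        = sym_t x (x + u) * (cmod (f (x + u)) * sqrt (\<pi> (x + u)))"
      by (simp add: t_mult_sqrt_pi)
    also have "\<dots> \<le> sup_kernel X u * (cmod (f (x + u)) * sqrt (\<pi> (x + u)))"
      by (intro mult_right_mono sym_t_le_sup_kernel x) simp
    finally show "ennreal (cmod (f (x + u)) * (t x (x + u) * sqrt (\<pi> x)))
        \<le> ennreal (sup_kernel X u) * ennreal (cmod (f (x + u)) * sqrt (\<pi> (x + u)))"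
      by (simp add: ennreal_leI flip: ennreal_mult'')
  qed
  finally show ?thesis .
qed

lemma L2_indicator_integral_part:
  assumes f: "f \<in> L2 \<pi>" and X: "X \<in> sets borel" "X \<noteq> {}"
  shows "(\<lambda>x. indicator X x * integral_part f x) \<in> L2 \<pi>"
    and "L2norm \<pi> (\<lambda>x. indicator X x * integral_part f x) \<le> beta X * L2norm \<pi> f"
proof -
  note [measurable] = L2_measurable[OF f] sup_kernel_measurable[OF X(2)] X(1)
  have "ennreal (cmod (indicator X x * integral_part f x) * sqrt (\<pi> x))
      \<le> (\<integral>\<^sup>+u. ennreal (sup_kernel X u) * ennreal (cmod (f (x + u)) * sqrt (\<pi> (x + u))) \<partial>lborel)" for x
    using cmod_integral_part_mult_sqrt_pi_le[OF f, of x X] by (cases "x \<in> X") simp_all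
  note L2_of_convolution_bound[OF f _ _ beta_nonneg[OF X(2)] nn_integral_sup_kernel[OF X(2)] this]
  then show "(\<lambda>x. indicator X x * integral_part f x) \<in> L2 \<pi>"
    and "L2norm \<pi> (\<lambda>x. indicator X x * integral_part f x) \<le> beta X * L2norm \<pi> f"
    by measurable
qed

lemma L2_bounded_op_integral_part: "L2_bounded_op \<pi> integral_part"
  using L2_indicator_integral_part[of _ UNIV]
  by (intro L2_bounded_opI[where C = "beta UNIV"] L2_linear_opI) (auto simp: integral_part_lincomb)

lemma L2_bounded_op_r: "L2_bounded_op \<pi> (\<lambda>f x. complex_of_real (r x) * f x)"
  by (rule L2_bounded_op_mult[where C = 1]) (auto simp: r_nonneg r_le_1)

lemma L2_bounded_op_mh_op: "L2_bounded_op \<pi> (mh_op \<pi> q)"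
  using L2_bounded_op_add[OF L2_bounded_op_r L2_bounded_op_integral_part] by (simp add: mh_op_eq[abs_def])

definition diag_part :: "real set \<Rightarrow> (real \<Rightarrow> complex) \<Rightarrow> real \<Rightarrow> complex" where
  "diag_part A f x = complex_of_real (r x) * f x
     + indicator (- A) x * integral_part (\<lambda>y. indicator (- A) y * f y) x"

definition compact_part :: "real set \<Rightarrow> (real \<Rightarrow> complex) \<Rightarrow> real \<Rightarrow> complex" where
  "compact_part A f x = indicator A x * integral_part f x
     + indicator (- A) x * integral_part (\<lambda>y. indicator A y * f y) x"

lemma mh_op_decomp:
  assumes f: "f \<in> L2 \<pi>" and A: "A \<in> sets borel"
  shows "mh_op \<pi> q f x = diag_part A f x + compact_part A f x"
proof -
  have "f = (\<lambda>y. 1 * (indicator A y * f y) + indicator (- A) y * f y)"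
    by (auto simp: indicator_def)
  then have "integral_part f x
      = integral_part (\<lambda>y. indicator A y * f y) x + integral_part (\<lambda>y. indicator (- A) y * f y) x"
    using integral_part_lincomb[OF L2_indicator_mult[OF f A]
        L2_indicator_mult[OF f borel_comp[OF A]], of 1 x]
    by simp
  then show ?thesis
    by (cases "x \<in> A") (auto simp: mh_op_eq diag_part_def compact_part_def)
qed

lemma L2_bounded_op_diag_part:
  assumes "A \<in> sets borel"
  shows "L2_bounded_op \<pi> (diag_part A)"
proof -
  have "L2_bounded_op \<pi> (\<lambda>f x. indicator (- A) x * f x)"
    by (rule L2_bounded_op_indicator[OF borel_comp[OF assms]])
  note L2_bounded_op_comp[OF this L2_bounded_op_comp[OF L2_bounded_op_integral_part this]]
  from L2_bounded_op_add[OF L2_bounded_op_r this] show ?thesis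
    unfolding diag_part_def[abs_def] .
qed

lemma L2_compact_op_compact_part:
  assumes A: "compact A"
  shows "L2_compact_op \<pi> (compact_part A)"
proof -
  obtain R where R: "\<And>x. x \<in> A \<Longrightarrow> \<bar>x\<bar> \<le> R"
    using compact_imp_bounded[OF A] by (auto simp: bounded_iff)
  define B where "B = {-(R + s)..R + s}"
  have t_eq_0_outside: "t x y = 0" "t y x = 0" if "x \<in> A" "y \<notin> B" for x y
    using R[OF that(1)] that(2) by (auto simp: B_def intro!: t_eq_0)
  have "compact B" by (simp add: B_def)
  have cont: "continuous_on S (\<lambda>(x, y). complex_t x y)" for S
    unfolding case_prod_unfold by (intro continuous_intros)
  have inside: "indicator A x * kernel_integral complex_t B f x = indicator A x * integral_part f x" for f x
    using integral_part_eq_kernel_integral[of B x f] t_eq_0_outside by (cases "x \<in> A") auto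
  have outside: "indicator B x * kernel_integral complex_t A f x
      = integral_part (\<lambda>y. indicator A y * f y) x" for f x
  proof (cases "x \<in> B")
    case False
    then have "indicator A y * f y * complex_t x y = 0" for y
      using t_eq_0_outside(2)[of y x] by (cases "y \<in> A") auto
    then have "integral_part (\<lambda>y. indicator A y * f y) x = 0"
      unfolding integral_part_def by (simp only: integral_zero)
    then show ?thesis using False by simp
  qed (simp add: integral_part_indicator_mult)
  have "L2_bounded_op \<pi> (\<lambda>f x. indicator (- A) x * f x)"
    by (intro L2_bounded_op_indicator borel_comp borel_compact A)
  from L2_compact_op_add[OF L2_compact_op_kernel_integral[OF A \<open>compact B\<close> cont]
      L2_compact_op_comp_left[OF this L2_compact_op_kernel_integral[OF \<open>compact B\<close> A cont]]]
  show ?thesis by (simp add: inside outside compact_part_def[abs_def])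
qed

definition alpha :: "real set \<Rightarrow> real" where
  "alpha A = max (SUP x\<in>A. r x) ((SUP x\<in>- A. r x) + beta (- A))"

lemma bdd_above_r: "bdd_above (r ` X)"
  by (intro bdd_aboveI2[where M = 1] r_le_1)

lemma r_le_alpha: "x \<in> A \<Longrightarrow> r x \<le> alpha A"
  using cSUP_upper[OF _ bdd_above_r, of x A] by (simp add: alpha_def le_max_iff_disj)

lemma alpha_nonneg: "A \<noteq> {} \<Longrightarrow> alpha A \<ge> 0"
  using order_trans[OF r_nonneg r_le_alpha] by blast

lemma L2norm_diag_part_inside_le:
  assumes f: "f \<in> L2 \<pi>" and A: "A \<in> sets borel" "A \<noteq> {}"
  shows "L2norm \<pi> (\<lambda>x. indicator A x * diag_part A f x) \<le> alpha A * L2norm \<pi> (\<lambda>x. indicator A x * f x)"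
proof (rule L2norm_le_cmult)
  show "alpha A \<ge> 0" by (rule alpha_nonneg[OF A(2)])
  show "cmod (indicator A x * diag_part A f x) \<le> alpha A * cmod (indicator A x * f x)" for x
    using r_nonneg[of x] r_le_alpha[of x A]
    by (cases "x \<in> A") (auto simp: diag_part_def norm_mult mult_right_mono)
qed (intro L2_indicator_mult L2_bounded_op_in[OF L2_bounded_op_diag_part] f A(1))+

lemma L2norm_diag_part_outside_le:
  assumes f: "f \<in> L2 \<pi>" and A: "A \<in> sets borel" "- A \<noteq> {}"
  shows "L2norm \<pi> (\<lambda>x. indicator (- A) x * diag_part A f x)
    \<le> alpha A * L2norm \<pi> (\<lambda>x. indicator (- A) x * f x)"
proof -
  define g where "g x = indicator (- A) x * f x" for x
  define r_sup where "r_sup = (SUP x\<in>- A. r x)"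
  have r_le: "r x \<le> r_sup" if "x \<in> - A" for x
    unfolding r_sup_def by (rule cSUP_upper[OF that bdd_above_r])
  have "- A \<in> sets borel" using A(1) by (rule borel_comp)
  then have g: "g \<in> L2 \<pi>" unfolding g_def by (rule L2_indicator_mult[OF f])
  have rg: "(\<lambda>x. complex_of_real (r x) * g x) \<in> L2 \<pi>"
    by (rule L2_bounded_op_in[OF L2_bounded_op_r g])
  have rg_le: "L2norm \<pi> (\<lambda>x. complex_of_real (r x) * g x) \<le> r_sup * L2norm \<pi> g"
  proof (rule L2norm_le_cmult[OF g rg])
    show "r_sup \<ge> 0" using A(2) order_trans[OF r_nonneg r_le] by blast
    show "cmod (complex_of_real (r x) * g x) \<le> r_sup * cmod (g x)" for x
      using r_nonneg[of x] r_le[of x]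
      by (cases "x \<in> - A") (auto simp: g_def norm_mult mult_right_mono)
  qed
  have "(\<lambda>x. indicator (- A) x * diag_part A f x)
      = (\<lambda>x. complex_of_real (r x) * g x + indicator (- A) x * integral_part g x)"
    by (auto simp: diag_part_def g_def[abs_def] indicator_def)
  then have "L2norm \<pi> (\<lambda>x. indicator (- A) x * diag_part A f x)
      \<le> L2norm \<pi> (\<lambda>x. complex_of_real (r x) * g x) + L2norm \<pi> (\<lambda>x. indicator (- A) x * integral_part g x)"
    using L2norm_triangle[OF rg L2_indicator_integral_part(1)[OF g \<open>- A \<in> sets borel\<close> A(2)]] by simp
  also have "\<dots> \<le> r_sup * L2norm \<pi> g + beta (- A) * L2norm \<pi> g"
    by (intro add_mono rg_le L2_indicator_integral_part(2)[OF g \<open>- A \<in> sets borel\<close> A(2)])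
  also have "\<dots> = (r_sup + beta (- A)) * L2norm \<pi> g" by (simp add: distrib_right)
  also have "\<dots> \<le> alpha A * L2norm \<pi> g"
    by (intro mult_right_mono) (simp_all add: alpha_def r_sup_def)
  finally show ?thesis unfolding g_def .
qed

lemma L2norm_diag_part_le:
  assumes f: "f \<in> L2 \<pi>" and A: "A \<in> sets borel" "A \<noteq> {}" "- A \<noteq> {}"
  shows "L2norm \<pi> (diag_part A f) \<le> alpha A * L2norm \<pi> f"
proof (rule L2norm_le_blockwise[OF f _ A(1)])
  show "diag_part A f \<in> L2 \<pi>" by (rule L2_bounded_op_in[OF L2_bounded_op_diag_part[OF A(1)] f])
  show "alpha A \<ge> 0" by (rule alpha_nonneg[OF A(2)])
qed (intro L2norm_diag_part_inside_le L2norm_diag_part_outside_le f A)+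

lemma ess_spec_radius_mh_op_le_alpha:
  assumes A: "compact A" "A \<noteq> {}"
  shows "ess_spec_radius \<pi> (mh_op \<pi> q) \<le> alpha A"
proof -
  have "A \<noteq> UNIV" using A(1) by auto
  then have "- A \<noteq> {}" by auto
  have borel: "A \<in> sets borel" using A(1) by (rule borel_compact)
  have "ess_spec_radius \<pi> (mh_op \<pi> q) \<le> ess_norm \<pi> (mh_op \<pi> q)"
    by (rule ess_spec_radius_le_ess_norm[OF L2_bounded_op_mh_op])
  also have "\<dots> \<le> L2_opnorm \<pi> (\<lambda>f x. mh_op \<pi> q f x - compact_part A f x)"
    by (rule ess_norm_le[OF L2_bounded_op_mh_op L2_compact_op_compact_part[OF A(1)]])
  also have "\<dots> \<le> alpha A"
  proof (rule L2_opnorm_le)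
    show "alpha A \<ge> 0" by (rule alpha_nonneg[OF A(2)])
    show "L2norm \<pi> (\<lambda>x. mh_op \<pi> q f x - compact_part A f x) \<le> alpha A * L2norm \<pi> f"
      if f: "f \<in> L2 \<pi>" for f
      using L2norm_diag_part_le[OF f borel A(2) \<open>- A \<noteq> {}\<close>] by (simp add: mh_op_decomp[OF f borel])
  qed
  finally show ?thesis .
qed

end

theorem theorem2p1:
  fixes \<pi> :: "real \<Rightarrow> real" and q :: "real \<Rightarrow> real \<Rightarrow> real" and s a :: real
  assumes pi_pos: "\<And>x. \<pi> x > 0"
    and pi_cont: "continuous_on UNIV \<pi>"
    and pi_int: "integrable lborel \<pi>"
    and pi_one: "(\<integral>x. \<pi> x \<partial>lborel) = 1"
    and q_nonneg: "\<And>x y. q x y \<ge> 0"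
    and q_bdd: "\<exists>B. \<forall>x y. q x y \<le> B"
    and q_cont: "continuous_on UNIV (\<lambda>(x, y). q x y)"
    and q_int: "\<And>x. integrable lborel (q x)"
    and q_one: "\<And>x. (\<integral>y. q x y \<partial>lborel) = 1"
    and s_pos: "s > 0"
    and q_supp: "\<And>x u. \<bar>u\<bar> > s \<Longrightarrow> q x (x + u) = 0"
    and a_pos: "a > 0"
  shows "ess_spec_radius \<pi> (mh_op \<pi> q) \<le>
           max (SUP x\<in>{x. \<bar>x\<bar> \<le> a}. mh_r \<pi> q x)
               ((SUP x\<in>{x. \<bar>x\<bar> > a}. mh_r \<pi> q x)
                + (LBINT u=-s..s. (SUP x\<in>{x. \<bar>x\<bar> > a}.
                      sqrt (mh_t \<pi> q x (x + u) * mh_t \<pi> q (x + u) x))))"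
proof -
  interpret metropolis_hastings \<pi> q s
    by unfold_locales (fact assms)+
  define A where "A = {x. \<bar>x\<bar> \<le> a}"
  have "A = cball 0 a" by (auto simp: A_def dist_norm)
  then have "compact A" "A \<noteq> {}" using a_pos by simp_all
  have outside: "{x. \<bar>x\<bar> > a} = - A" by (auto simp: A_def)
  have "(LBINT u=-s..s. (SUP x\<in>- A. sqrt (t x (x + u) * t (x + u) x))) = beta (- A)"
    using s_pos by (simp add: interval_integral_Icc beta_def sup_kernel_def sym_t_def)
  with ess_spec_radius_mh_op_le_alpha[OF \<open>compact A\<close> \<open>A \<noteq> {}\<close>] show ?thesis
    by (simp add: outside alpha_def flip: A_def)
qed

end
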